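(* Let $f:\mathbb{R}^{n_x}\times\mathbb{R}^{n_e}\to\mathbb{R}^{n_x}$ and $g:\mathbb{R}^{n_x}\times\mathbb{R}^{n_e}\to\mathbb{R}^{n_e}$ be continuous, let $\delta\in\mathcal{K}_\infty$ and $\sigma\in(0,1)$. Suppose the following conditions hold. (i) (a) There exist a smooth function $V:\mathbb{R}^{n_x}\to\mathbb{R}$ and $\underline{\alpha}_V,\overline{\alpha}_V,\alpha,\gamma\in\mathcal{K}_\infty$ such that $\underline{\alpha}_V(|x|)\le V(x)\le\overline{\alpha}_V(|x|)$ for all $x\in\mathbb{R}^{n_x}$ and $$\frac{\partial V}{\partial x}f(x,e)\le-\alpha(V(x))+\gamma(|e|)\quad\text{for all }(x,e)\in\mathbb{R}^{n_x+n_e}.$$ (b) With $\tilde\gamma(s)=\alpha^{-1}(\sigma^{-1}\gamma(s))$ for $s\ge0$: for any compact set $S\subset\mathbb{R}^{n_x+n_e}$ there exist $L_1,L_2\in\mathbb{R}_{\ge0}$ such that for all $(x,e)\in S$, $|f(x,e)|\le L_1(|x|+|e|)$ and $\underline{\alpha}_V^{-1}(\tilde\gamma(|e|))\le L_2|e|$. (ii) The function $\tilde\gamma$ is locally Lipschitz. (iii) For any compact set $S\subset\mathbb{R}^{n_x+n_e}$ there exists $L_3\in\mathbb{R}_{\ge0}$ such that for all $(x,e)\in S$, $|g(x,e)|\le L_3(|x|+|e|)$. Let $W(e)=\tilde\gamma(|e|)$ and consider the hybrid system with state $q=(x,e,\eta)\in\mathbb{R}^{n_q}=\mathbb{R}^{n_x}\times\mathbb{R}^{n_e}\times\mathbb{R}$,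 $$\left.\begin{array}{rcl}\dot x&=&f(x,e)\\ \dot e&=&g(x,e)\\ \dot\eta&=&-\delta(\eta)\end{array}\right\}\ q\in C,\qquad\left.\begin{array}{rcl}x^+&=&x\\ e^+&=&0\\ \eta^+&=&W(e)\end{array}\right\}\ q\in D,$$ where $$C=\{q:\max\{V(x),\eta\}\ge W(e)\text{ and }\eta\ge0\},\qquad D=\{q:\max\{V(x),\eta\}\le W(e)\text{ and }\eta\ge0\}.$$ Then $q=(x,e,\eta)=0$ is semiglobally asymptotically stable (S-GAS) for this system, i.e. the set $\mathcal{A}=\{0\}$ is S-GAS, and solutions to this system have a semiglobal dwell time on $\mathbb{R}^{n_q}\setminus\{0\}$.
   Context: Origin of the model: $x$ collects plant and controller states, $e$ is the sampling-induced error, $\eta$ is an auxiliary threshold variable; jumps are transmissions. Function classes. $\gamma:\mathbb{R}_{\ge0}\to\mathbb{R}_{\ge0}$ is of class $\mathcal{K}$ if it is continuous, zero at zero and strictly increasing; of class $\mathcal{K}_\infty$ if in addition unbounded. A continuous $\gamma:\mathbb{R}_{\ge0}^2\to\mathbb{R}_{\ge0}$ is of class $\mathcal{KL}$ if $\gamma(\cdot,t)\in\mathcal{K}$ for each $t\ge0$ and $\gamma(s,\cdot)$ is decreasing to zero for each $s>0$. $\beta:\mathbb{R}_{\ge0}^3\to\mathbb{R}_{\ge0}$ is of class $\mathcal{KLL}$ if $\beta(\cdot,\cdot,t)\in\mathcal{KL}$ and $\beta(\cdot,t,\cdot)\in\mathcal{KL}$ for any $t\ge0$. Distance: $|x|_{\mathcal{A}}=\inf\{|x-y|:y\in\mathcal{A}\}$.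 Hybrid systems. For $\dot q=F(q)$, $q\in C$; $q^+=G(q)$, $q\in D$: a set $E\subset\mathbb{R}_{\ge0}\times\mathbb{Z}_{\ge0}$ is a compact hybrid time domain if $E=\bigcup_{j\in\{0,\dots,J\}}([t_j,t_{j+1}],j)$ for some finite sequence $0=t_0\le t_1\le\dots$; $E$ is a hybrid time domain if for all $(T,J)\in E$, $E\cap([0,T]\times\{0,\dots,J\})$ is a compact hybrid time domain. A hybrid arc is a function $\phi$ on a hybrid time domain $\mathrm{dom}\,\phi$ such that $\phi(\cdot,j)$ is locally absolutely continuous for each $j$. A hybrid arc $\phi$ is a solution if (1) for all $j$ and almost all $t$ with $(t,j)\in\mathrm{dom}\,\phi$: $\phi(t,j)\in C$ and $\dot\phi(t,j)=F(\phi(t,j))$; (2) for $(t,j)\in\mathrm{dom}\,\phi$ with $(t,j+1)\in\mathrm{dom}\,\phi$: $\phi(t,j)\in D$ and $\phi(t,j+1)=G(\phi(t,j))$. Solutions are not required to be unique or complete. Forward invariance: $\mathcal{A}$ is forward invariant if every solution $\phi$ with $\phi(0,0)\in\mathcal{A}$ satisfies $\phi(t,j)\in\mathcal{A}$ for all $(t,j)\in\mathrm{dom}\,\phi$. S-GAS: the closed set $\mathcal{A}$ is semiglobally asymptotically stable if for any $\Delta>0$ there exists $\beta_\Delta\in\mathcal{KLL}$ such that every solution $\phi$ with $|\phi(0,0)|_{\mathcal{A}}\le\Delta$ satisfies $|\phi(t,j)|_{\mathcal{A}}\le\beta_\Delta(|\phi(0,0)|_{\mathcal{A}},t,j)$ for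 all $(t,j)\in\mathrm{dom}\,\phi$. Semiglobal dwell time: for a forward invariant set $\mathcal{A}\subset\mathbb{R}^{n}$, solutions have a semiglobal dwell time on $\mathbb{R}^n\setminus\mathcal{A}$ if for any $\Delta>0$ there exists $\tau(\Delta)>0$ such that for any solution $\phi$ with $|\phi(0,0)|_{\mathcal{A}}\le\Delta$, writing $\mathrm{dom}\,\phi=\bigcup([t_j,t_{j+1}],j)$, and for any two successive jump times $t_j,t_{j+1}$ of $\phi$ (so $j\ge1$ and $(t_{j+1},j+1)\in\mathrm{dom}\,\phi$): if $\phi(t,j)\notin\mathcal{A}$ for all $t\in[t_j,t_{j+1}]$, then $t_{j+1}-t_j\ge\tau(\Delta)$. *)

theory Defs
  imports "HOL-Analysis.Analysis"
begin

section \<open>Comparison functions\<close>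

text \<open>
  Functions on the nonnegative reals are represented by functions on \<open>real\<close> that are
  constrained on \<open>{0..}\<close> only; their values at negative arguments are irrelevant.
\<close>

definition class_K :: "(real \<Rightarrow> real) \<Rightarrow> bool" where
  "class_K \<gamma> \<longleftrightarrow>
     \<gamma> ` {0..} \<subseteq> {0..} \<and> continuous_on {0..} \<gamma> \<and> \<gamma> 0 = 0 \<and> strict_mono_on {0..} \<gamma>"

definition class_Kinf :: "(real \<Rightarrow> real) \<Rightarrow> bool" where
  "class_Kinf \<gamma> \<longleftrightarrow> class_K \<gamma> \<and> \<not> bdd_above (\<gamma> ` {0..})"

definition class_KL :: "(real \<Rightarrow> real \<Rightarrow> real) \<Rightarrow> bool" where
  "class_KL \<gamma> \<longleftrightarrow>
     (\<forall>s\<ge>0. \<forall>t\<ge>0. 0 \<le> \<gamma> s t) \<and>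
     continuous_on ({0..} \<times> {0..}) (\<lambda>(s, t). \<gamma> s t) \<and>
     (\<forall>t\<ge>0. class_K (\<lambda>s. \<gamma> s t)) \<and>
     (\<forall>s>0. antimono_on {0..} (\<gamma> s) \<and> (\<gamma> s \<longlongrightarrow> 0) at_top)"

definition class_KLL :: "(real \<Rightarrow> real \<Rightarrow> real \<Rightarrow> real) \<Rightarrow> bool" where
  "class_KLL \<beta> \<longleftrightarrow>
     (\<forall>t\<ge>0. class_KL (\<lambda>s u. \<beta> s u t) \<and> class_KL (\<lambda>s u. \<beta> s t u))"

text \<open>
  A class \<open>class_Kinf\<close> function is a bijection of \<open>{0..}\<close> onto itself; this is its inverse there.
\<close>

abbreviation K_inverse :: "(real \<Rightarrow> real) \<Rightarrow> real \<Rightarrow> real" where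
  "K_inverse \<alpha> \<equiv> inv_into {0..} \<alpha>"


section \<open>Regularity of functions\<close>

text \<open>Smoothness means existence and continuity of the iterated directional derivatives of all orders.\<close>

primrec times_differentiable ::
    "nat \<Rightarrow> ('a::real_normed_vector \<Rightarrow> 'b::real_normed_vector) \<Rightarrow> bool" where
  "times_differentiable 0 h \<longleftrightarrow> continuous_on UNIV h"
| "times_differentiable (Suc k) h \<longleftrightarrow>
     (\<forall>x. h differentiable (at x)) \<and>
     (\<forall>v. times_differentiable k (\<lambda>x. frechet_derivative h (at x) v))"

definition smooth :: "('a::real_normed_vector \<Rightarrow> 'b::real_normed_vector) \<Rightarrow> bool" where
  "smooth h \<longleftrightarrow> (\<forall>k. times_differentiable k h)"

definition locally_lipschitz_on ::
    "'a::metric_space set \<Rightarrow> ('a \<Rightarrow> 'b::metric_space) \<Rightarrow> bool" where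
  "locally_lipschitz_on X h \<longleftrightarrow> (\<forall>x\<in>X. \<exists>u>0. \<exists>L. L-lipschitz_on (cball x u \<inter> X) h)"

text \<open>Below, \<open>P\<close> is a finite family of non-overlapping intervals, each given by its endpoints.\<close>

definition absolutely_continuous_on_interval ::
    "real \<Rightarrow> real \<Rightarrow> (real \<Rightarrow> 'a::real_normed_vector) \<Rightarrow> bool" where
  "absolutely_continuous_on_interval a b h \<longleftrightarrow>
     (\<forall>\<epsilon>>0. \<exists>\<delta>>0. \<forall>P :: (real \<times> real) set.
        finite P \<and> (\<forall>(u, v)\<in>P. a \<le> u \<and> u \<le> v \<and> v \<le> b) \<and>
        disjoint_family_on (\<lambda>(u, v). {u<..<v}) P \<and> (\<Sum>(u, v)\<in>P. v - u) < \<delta>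
        \<longrightarrow> (\<Sum>(u, v)\<in>P. norm (h v - h u)) < \<epsilon>)"

definition locally_absolutely_continuous_on ::
    "real set \<Rightarrow> (real \<Rightarrow> 'a::real_normed_vector) \<Rightarrow> bool" where
  "locally_absolutely_continuous_on I h \<longleftrightarrow>
     (\<forall>a b. a \<le> b \<and> {a..b} \<subseteq> I \<longrightarrow> absolutely_continuous_on_interval a b h)"


section \<open>Hybrid systems and their solutions\<close>

definition compact_hybrid_time_domain :: "(real \<times> nat) set \<Rightarrow> bool" where
  "compact_hybrid_time_domain E \<longleftrightarrow>
     (\<exists>(J::nat) (t::nat \<Rightarrow> real). t 0 = 0 \<and> (\<forall>j\<le>J. t j \<le> t (Suc j)) \<and>
        E = (\<Union>j\<le>J. {t j..t (Suc j)} \<times> {j}))"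

definition hybrid_time_domain :: "(real \<times> nat) set \<Rightarrow> bool" where
  "hybrid_time_domain E \<longleftrightarrow>
     E \<subseteq> {0..} \<times> UNIV \<and>
     (\<forall>(T, J)\<in>E. compact_hybrid_time_domain (E \<inter> {0..T} \<times> {..J}))"

text \<open>A hybrid arc is given by its domain \<open>E\<close> and a function whose values outside \<open>E\<close> are irrelevant.\<close>

definition hybrid_arc ::
    "(real \<times> nat) set \<Rightarrow> (real \<Rightarrow> nat \<Rightarrow> 'q::real_normed_vector) \<Rightarrow> bool" where
  "hybrid_arc E \<phi> \<longleftrightarrow>
     hybrid_time_domain E \<and>
     (\<forall>j. locally_absolutely_continuous_on {t. (t, j) \<in> E} (\<lambda>t. \<phi> t j))"

record 'q hybrid_system =
  flow_map :: "'q \<Rightarrow> 'q"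
  flow_set :: "'q set"
  jump_map :: "'q \<Rightarrow> 'q"
  jump_set :: "'q set"

definition hybrid_solution ::
    "'q::real_normed_vector hybrid_system \<Rightarrow> (real \<times> nat) set \<Rightarrow> (real \<Rightarrow> nat \<Rightarrow> 'q) \<Rightarrow> bool" where
  "hybrid_solution H E \<phi> \<longleftrightarrow>
     hybrid_arc E \<phi> \<and>
     (\<forall>j. AE t in lebesgue. (t, j) \<in> E \<longrightarrow>
        \<phi> t j \<in> flow_set H \<and>
        ((\<lambda>s. \<phi> s j) has_vector_derivative flow_map H (\<phi> t j)) (at t within {s. (s, j) \<in> E})) \<and>
     (\<forall>t j. (t, j) \<in> E \<and> (t, Suc j) \<in> E \<longrightarrow>
        \<phi> t j \<in> jump_set H \<and> \<phi> t (Suc j) = jump_map H (\<phi> t j))"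

definition forward_invariant :: "'q::real_normed_vector hybrid_system \<Rightarrow> 'q set \<Rightarrow> bool" where
  "forward_invariant H A \<longleftrightarrow>
     (\<forall>E \<phi>. hybrid_solution H E \<phi> \<and> \<phi> 0 0 \<in> A \<longrightarrow> (\<forall>(t, j)\<in>E. \<phi> t j \<in> A))"

definition S_GAS :: "'q::real_normed_vector hybrid_system \<Rightarrow> 'q set \<Rightarrow> bool" where
  "S_GAS H A \<longleftrightarrow>
     closed A \<and>
     (\<forall>\<Delta>>0. \<exists>\<beta>. class_KLL \<beta> \<and>
        (\<forall>E \<phi>. hybrid_solution H E \<phi> \<and> infdist (\<phi> 0 0) A \<le> \<Delta> \<longrightarrow>
           (\<forall>(t, j)\<in>E. infdist (\<phi> t j) A \<le> \<beta> (infdist (\<phi> 0 0) A) t (real j))))"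

definition jump_time :: "(real \<times> nat) set \<Rightarrow> nat \<Rightarrow> real \<Rightarrow> bool" where
  "jump_time E j t \<longleftrightarrow> (t, j) \<in> E \<and> (t, Suc j) \<in> E"

lemma jump_time_compact_iff:
  assumes "\<And>j. j \<le> J \<Longrightarrow> t j \<le> t (Suc j)"
    and "E = (\<Union>j\<le>J. {t j..t (Suc j)} \<times> {j})"
  shows "jump_time E j s \<longleftrightarrow> j < J \<and> s = t (Suc j)"
  using assms(1)[of j] assms(1)[of "Suc j"] unfolding jump_time_def assms(2) by auto

text \<open>
  The two jumps below are the one from \<open>j\<close> to \<open>Suc j\<close> and the next one, so that the
  flow interval between them has index \<open>Suc j\<close>; the initial flow interval is not constrained.
\<close>

definition semiglobal_dwell_time :: "'q::real_normed_vector hybrid_system \<Rightarrow> 'q set \<Rightarrow> bool" where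
  "semiglobal_dwell_time H A \<longleftrightarrow>
     forward_invariant H A \<and>
     (\<forall>\<Delta>>0. \<exists>\<tau>>0. \<forall>E \<phi>. hybrid_solution H E \<phi> \<and> infdist (\<phi> 0 0) A \<le> \<Delta> \<longrightarrow>
        (\<forall>j s s'. jump_time E j s \<and> jump_time E (Suc j) s' \<and>
           (\<forall>t\<in>{s..s'}. \<phi> t (Suc j) \<notin> A) \<longrightarrow> s' - s \<ge> \<tau>))"


section \<open>The event-triggered control system\<close>

definition gamma_tilde :: "real \<Rightarrow> (real \<Rightarrow> real) \<Rightarrow> (real \<Rightarrow> real) \<Rightarrow> real \<Rightarrow> real" where
  "gamma_tilde \<sigma> \<alpha> \<gamma> s = K_inverse \<alpha> (inverse \<sigma> * \<gamma> s)"

definition event_triggered_system ::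
    "('x \<times> 'e \<Rightarrow> 'x) \<Rightarrow> ('x \<times> 'e \<Rightarrow> 'e) \<Rightarrow> (real \<Rightarrow> real) \<Rightarrow> ('x \<Rightarrow> real) \<Rightarrow> ('e \<Rightarrow> real)
     \<Rightarrow> ('x::real_normed_vector \<times> 'e::real_normed_vector \<times> real) hybrid_system" where
  "event_triggered_system f g \<delta> V W =
     \<lparr> flow_map = (\<lambda>(x, e, \<eta>). (f (x, e), g (x, e), - \<delta> \<eta>)),
       flow_set = {(x, e, \<eta>). max (V x) \<eta> \<ge> W e \<and> \<eta> \<ge> 0},
       jump_map = (\<lambda>(x, e, \<eta>). (x, 0, W e)),
       jump_set = {(x, e, \<eta>). max (V x) \<eta> \<le> W e \<and> \<eta> \<ge> 0} \<rparr>"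

end

theory Submission
  imports Defs
begin

text \<open>
  The energy \<open>max (V x) (max \<bar>\<eta>\<bar> (W e))\<close> does not increase at jumps, and as long as it is at
  least \<open>c\<close> it decreases along flows at rate at least \<open>\<rho> c\<close>, where
  \<open>\<rho> = min ((1 - \<sigma>) * \<alpha>) \<delta>\<close>. Starting from \<open>s\<close> it is thus at most \<open>u = max c (s - \<rho> c * t)\<close> for
  every \<open>c \<ge> 0\<close>, and choosing \<open>c\<close> with \<open>\<rho> c = (\<rho> s + s) / (1 + t)\<close> gives \<open>u = c\<close>, a bound of class KL
  without any comparison principle. Between two jumps \<open>e\<close> has to grow from zero until it dominates \<open>x\<close>
  while the dynamics are linearly bounded, which takes a minimal time. So until the state vanishes
  the number of jumps is at most affine in the elapsed time, and decay in time is also decay in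
  the number of jumps.
\<close>

section \<open>Absolutely continuous functions\<close>

text \<open>A solution satisfies its differential equation and lies in the flow set only at almost
  every time, and the energy is a maximum of functions that need not be smooth together. Therefore
  \<open>V x\<close> and \<open>\<eta>\<close> are held separately below one common barrier.
  Freezing the level \<open>c\<close> gives this barrier the constant slope
  \<open>- decay c\<close>, so an increment bound for absolutely continuous functions suffices. The
  obstacle to decay in the number of jumps is the origin: it lies in the flow set and in the jump
  set and the jump map fixes it, so any number of jumps can occur there at a single time. Jumps are
  counted only before the state vanishes; afterwards the state stays zero and every bound holds. Off
  the origin, \<open>K_inverse \<alpha>V_low (W e) \<le> L2 * norm e\<close> turns the nonlinear
  jump condition into a linear domination of \<open>x\<close> by \<open>e\<close>. All estimates
  between jumps are then homogeneous in the size of the state, so the minimal time does not shrink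
  near the origin.\<close>

lemma absolutely_continuous_on_intervalE:
  assumes "absolutely_continuous_on_interval a b h" "\<epsilon> > 0"
  obtains \<delta> where "\<delta> > 0"
    "\<And>P. \<lbrakk>finite P; \<And>u v. (u, v) \<in> P \<Longrightarrow> a \<le> u \<and> u \<le> v \<and> v \<le> b;
       disjoint_family_on (\<lambda>(u, v). {u<..<v}) P; (\<Sum>(u, v)\<in>P. v - u) < \<delta>\<rbrakk>
       \<Longrightarrow> (\<Sum>(u, v)\<in>P. norm (h v - h u)) < \<epsilon>"
proof -
  from assms obtain \<delta> where "\<delta> > 0" and *: "\<forall>P :: (real \<times> real) set.
        finite P \<and> (\<forall>(u, v)\<in>P. a \<le> u \<and> u \<le> v \<and> v \<le> b) \<and>
        disjoint_family_on (\<lambda>(u, v). {u<..<v}) P \<and> (\<Sum>(u, v)\<in>P. v - u) < \<delta>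
        \<longrightarrow> (\<Sum>(u, v)\<in>P. norm (h v - h u)) < \<epsilon>"
    unfolding absolutely_continuous_on_interval_def by blast
  show thesis
  proof (rule that[OF \<open>\<delta> > 0\<close>])
    fix P :: "(real \<times> real) set"
    assume "finite P" and "\<And>u v. (u, v) \<in> P \<Longrightarrow> a \<le> u \<and> u \<le> v \<and> v \<le> b"
      and "disjoint_family_on (\<lambda>(u, v). {u<..<v}) P" and "(\<Sum>(u, v)\<in>P. v - u) < \<delta>"
    then show "(\<Sum>(u, v)\<in>P. norm (h v - h u)) < \<epsilon>"
      by (intro *[rule_format]) auto
  qed
qed

lemma absolutely_continuous_on_interval_subset:
  assumes "absolutely_continuous_on_interval a b h" "a \<le> a'" "b' \<le> b"
  shows "absolutely_continuous_on_interval a' b' h"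
  unfolding absolutely_continuous_on_interval_def
proof (intro allI impI)
  fix \<epsilon> :: real assume "\<epsilon> > 0"
  from absolutely_continuous_on_intervalE[OF assms(1) this] obtain \<delta> where "\<delta> > 0"
    and \<delta>: "\<And>P. \<lbrakk>finite P; \<And>u v. (u, v) \<in> P \<Longrightarrow> a \<le> u \<and> u \<le> v \<and> v \<le> b;
       disjoint_family_on (\<lambda>(u, v). {u<..<v}) P; (\<Sum>(u, v)\<in>P. v - u) < \<delta>\<rbrakk>
       \<Longrightarrow> (\<Sum>(u, v)\<in>P. norm (h v - h u)) < \<epsilon>"
    by metis
  show "\<exists>\<delta>>0. \<forall>P :: (real \<times> real) set.
        finite P \<and> (\<forall>(u, v)\<in>P. a' \<le> u \<and> u \<le> v \<and> v \<le> b') \<and>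
        disjoint_family_on (\<lambda>(u, v). {u<..<v}) P \<and> (\<Sum>(u, v)\<in>P. v - u) < \<delta>
        \<longrightarrow> (\<Sum>(u, v)\<in>P. norm (h v - h u)) < \<epsilon>"
    using assms(2,3) by (intro exI[of _ \<delta>] conjI \<open>\<delta> > 0\<close> allI impI \<delta>) fastforce+
qed

text \<open>Only increments are compared, so one statement covers components of a solution, inner
  products with a fixed vector, and \<open>V\<close> along a trajectory, where a Lipschitz constant
  is available just on a ball.\<close>

lemma absolutely_continuous_on_interval_dominated:
  fixes h :: "real \<Rightarrow> 'a::real_normed_vector" and y :: "real \<Rightarrow> 'b::real_normed_vector"
  assumes ac: "absolutely_continuous_on_interval a b h"
    and le: "\<And>u v. \<lbrakk>a \<le> u; u \<le> v; v \<le> b\<rbrakk> \<Longrightarrow> norm (y v - y u) \<le> L * norm (h v - h u)"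
  shows "absolutely_continuous_on_interval a b y"
  unfolding absolutely_continuous_on_interval_def
proof (intro allI impI)
  fix \<epsilon> :: real assume "\<epsilon> > 0"
  \<comment> \<open>\<open>\<bar>L\<bar> + 1\<close> replaces \<open>L\<close>, which may be zero or
    negative.\<close>
  then have "\<epsilon> / (\<bar>L\<bar> + 1) > 0" by simp
  from absolutely_continuous_on_intervalE[OF ac this] obtain \<delta> where "\<delta> > 0"
    and \<delta>: "\<And>P. \<lbrakk>finite P; \<And>u v. (u, v) \<in> P \<Longrightarrow> a \<le> u \<and> u \<le> v \<and> v \<le> b;
       disjoint_family_on (\<lambda>(u, v). {u<..<v}) P; (\<Sum>(u, v)\<in>P. v - u) < \<delta>\<rbrakk>
       \<Longrightarrow> (\<Sum>(u, v)\<in>P. norm (h v - h u)) < \<epsilon> / (\<bar>L\<bar> + 1)"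
    by metis
  show "\<exists>\<delta>>0. \<forall>P :: (real \<times> real) set.
        finite P \<and> (\<forall>(u, v)\<in>P. a \<le> u \<and> u \<le> v \<and> v \<le> b) \<and>
        disjoint_family_on (\<lambda>(u, v). {u<..<v}) P \<and> (\<Sum>(u, v)\<in>P. v - u) < \<delta>
        \<longrightarrow> (\<Sum>(u, v)\<in>P. norm (y v - y u)) < \<epsilon>"
  proof (intro exI[of _ \<delta>] conjI \<open>\<delta> > 0\<close> allI impI, elim conjE)
    fix P :: "(real \<times> real) set"
    assume P: "finite P" "\<forall>(u, v)\<in>P. a \<le> u \<and> u \<le> v \<and> v \<le> b"
      "disjoint_family_on (\<lambda>(u, v). {u<..<v}) P" "(\<Sum>(u, v)\<in>P. v - u) < \<delta>"
    have "(\<Sum>(u, v)\<in>P. norm (y v - y u)) \<le> (\<Sum>(u, v)\<in>P. (\<bar>L\<bar> + 1) * norm (h v - h u))"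
    proof (rule sum_mono, clarify)
      fix u v assume "(u, v) \<in> P"
      then have "norm (y v - y u) \<le> L * norm (h v - h u)" using P(2) le by blast
      also have "\<dots> \<le> (\<bar>L\<bar> + 1) * norm (h v - h u)" by (intro mult_right_mono) auto
      finally show "norm (y v - y u) \<le> (\<bar>L\<bar> + 1) * norm (h v - h u)" .
    qed
    also have "\<dots> = (\<bar>L\<bar> + 1) * (\<Sum>(u, v)\<in>P. norm (h v - h u))"
      by (simp add: sum_distrib_left case_prod_unfold)
    also have "\<dots> < (\<bar>L\<bar> + 1) * (\<epsilon> / (\<bar>L\<bar> + 1))"
      using P by (intro mult_strict_left_mono \<delta>) auto
    finally show "(\<Sum>(u, v)\<in>P. norm (y v - y u)) < \<epsilon>" by simp
  qed
qed

lemma absolutely_continuous_on_interval_imp_continuous_on: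
  fixes h :: "real \<Rightarrow> 'a::real_normed_vector"
  assumes ac: "absolutely_continuous_on_interval a b h"
  shows "continuous_on {a..b} h"
  unfolding continuous_on_iff
proof (intro ballI allI impI)
  fix t \<epsilon> :: real assume t: "t \<in> {a..b}" and "\<epsilon> > 0"
  from absolutely_continuous_on_intervalE[OF ac this(2)] obtain \<delta> where "\<delta> > 0"
    and \<delta>: "\<And>P. \<lbrakk>finite P; \<And>u v. (u, v) \<in> P \<Longrightarrow> a \<le> u \<and> u \<le> v \<and> v \<le> b;
       disjoint_family_on (\<lambda>(u, v). {u<..<v}) P; (\<Sum>(u, v)\<in>P. v - u) < \<delta>\<rbrakk>
       \<Longrightarrow> (\<Sum>(u, v)\<in>P. norm (h v - h u)) < \<epsilon>"
    by metis
  show "\<exists>d>0. \<forall>s\<in>{a..b}. dist s t < d \<longrightarrow> dist (h s) (h t) < \<epsilon>"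
  proof (intro exI[of _ \<delta>] conjI \<open>\<delta> > 0\<close> ballI impI)
    fix s assume "s \<in> {a..b}" "dist s t < \<delta>"
    then show "dist (h s) (h t) < \<epsilon>"
      using t \<delta>[of "{(min s t, max s t)}"]
      by (cases "s \<le> t") (auto simp: disjoint_family_on_def dist_norm norm_minus_commute min_def max_def)
  qed
qed

text \<open>
  Cousin's lemma replaces the Vitali covering argument: tags in the exceptional null set are forced
  into an open set of small measure, where absolute continuity bounds the increments, and at the
  other tags the derivative does.
\<close>

lemma absolutely_continuous_increment_le:
  fixes h :: "real \<Rightarrow> real"
  assumes "a \<le> b" and ac: "absolutely_continuous_on_interval a b h"
    and der: "AE t in lebesgue. t \<in> {a..b} \<longrightarrow>
      (\<exists>D\<le>K. (h has_vector_derivative D) (at t within {a..b}))"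
  shows "h b - h a \<le> K * (b - a)"
proof -
  from der obtain N where "N \<in> null_sets lebesgue"
    and N: "\<And>t. \<lbrakk>t \<in> {a..b}; t \<notin> N\<rbrakk> \<Longrightarrow> \<exists>D\<le>K. (h has_vector_derivative D) (at t within {a..b})"
    by (rule AE_E3) auto
  have eps: "h b - h a \<le> K * (b - a) + \<epsilon> * (1 + \<bar>K\<bar> + (b - a))" if "\<epsilon> > 0" for \<epsilon>
  proof -
    from absolutely_continuous_on_intervalE[OF ac that] obtain \<delta> where "\<delta> > 0"
      and \<delta>: "\<And>P. \<lbrakk>finite P; \<And>u v. (u, v) \<in> P \<Longrightarrow> a \<le> u \<and> u \<le> v \<and> v \<le> b;
         disjoint_family_on (\<lambda>(u, v). {u<..<v}) P; (\<Sum>(u, v)\<in>P. v - u) < \<delta>\<rbrakk>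
         \<Longrightarrow> (\<Sum>(u, v)\<in>P. norm (h v - h u)) < \<epsilon>"
      by metis
    \<comment> \<open>\<open>e\<close> will exceed the total length of the intervals with
      exceptional tags: \<open>\<delta>\<close> makes their increments small,
      \<open>\<epsilon>\<close> makes their share of \<open>K * (b - a)\<close> small.\<close>
    define e where "e = min \<delta> \<epsilon>"
    have "e > 0" using \<open>\<delta> > 0\<close> that by (simp add: e_def)
    obtain T where T: "open T" "N \<subseteq> T" "T - N \<in> lmeasurable" "emeasure lebesgue (T - N) < ennreal e"
      using sets_lebesgue_outer_open[of N e] \<open>e > 0\<close> \<open>N \<in> null_sets lebesgue\<close> by auto
    have Tm: "T \<in> lmeasurable"
      using T(1,3) \<open>N \<in> null_sets lebesgue\<close>
      by (metis borel_open measurable_Diff_null_set sets_completionI_sets sets_lborel)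
    have mT: "measure lebesgue T < e"
      using T(1,3,4) \<open>N \<in> null_sets lebesgue\<close> \<open>e > 0\<close>
      by (metis borel_open emeasure_eq_measure2 ennreal_less_iff measure_Diff_null_set
          measure_nonneg sets_completionI_sets sets_lborel)
    have "\<exists>r>0. t \<in> {a..b} \<longrightarrow> t \<notin> N \<longrightarrow> (\<exists>D\<le>K. \<forall>s\<in>{a..b}. \<bar>s - t\<bar> < r \<longrightarrow>
        \<bar>h s - h t - (s - t) * D\<bar> \<le> \<epsilon> * \<bar>s - t\<bar>)" for t
    proof (cases "t \<in> {a..b} \<and> t \<notin> N")
      case True
      then obtain D where "D \<le> K" "(h has_vector_derivative D) (at t within {a..b})"
        using N by blast
      then show ?thesis
        using \<open>\<epsilon> > 0\<close> unfolding has_vector_derivative_def has_derivative_within_alt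
        by (fastforce simp: abs_minus_commute)
    qed (auto intro: exI[of _ 1])
    then obtain r where r: "\<And>t. r t > 0"
      and rD: "\<And>t. \<lbrakk>t \<in> {a..b}; t \<notin> N\<rbrakk> \<Longrightarrow> \<exists>D\<le>K. \<forall>s\<in>{a..b}. \<bar>s - t\<bar> < r t \<longrightarrow>
        \<bar>h s - h t - (s - t) * D\<bar> \<le> \<epsilon> * \<bar>s - t\<bar>"
      by metis
    define G where "G = (\<lambda>t. if t \<in> N then T else ball t (r t))"
    have "gauge G" using T(1,2) r by (auto simp: gauge_def G_def)
    then obtain p where p: "p tagged_division_of {a..b}" and fine: "G fine p"
      by (rule fine_division_exists_real)
    note finp = tagged_division_ofD(1)[OF p]
    \<comment> \<open>Here \<open>K\<close> is a tagged interval and hides the bound on the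
      derivative; in sums where that bound occurs the intervals are called \<open>L\<close>.\<close>
    have pK: "x \<in> K" "K \<subseteq> {a..b}" "K = {Inf K..Sup K}" "a \<le> Inf K" "Inf K \<le> x" "x \<le> Sup K" "Sup K \<le> b"
      if xKp: "(x, K) \<in> p" for x K
    proof -
      obtain u v where uv: "K = {u..v}" using tagged_division_ofD(4)[OF p xKp] by auto
      show xK: "x \<in> K" and Ks: "K \<subseteq> {a..b}"
        using tagged_division_ofD(2,3)[OF p xKp] by auto
      then have "u \<le> v" using uv by auto
      then show "K = {Inf K..Sup K}" "a \<le> Inf K" "Inf K \<le> x" "x \<le> Sup K" "Sup K \<le> b"
        using xK Ks uv by auto
    qed
    define A where "A = {(x, K) \<in> p. x \<in> N}"
    have finA: "finite A" and Ap: "A \<subseteq> p" using finp by (auto simp: A_def intro: finite_subset)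
    define P where "P = (\<lambda>(x, K). (Inf K, Sup K)) ` A"
    \<comment> \<open>Dropping the tags loses nothing: two tags on the same interval force its
      interior to be empty, and an interval that is a single point admits only one tag.\<close>
    have inj: "inj_on (\<lambda>(x, K). (Inf K, Sup K :: real)) A"
    proof (rule inj_onI, clarify)
      fix x K x' K' assume *: "(x, K) \<in> A" "(x', K') \<in> A" "Inf K = Inf K'" "Sup K = Sup K'"
      then have p2: "(x, K) \<in> p" "(x', K') \<in> p" using Ap by auto
      have KK: "K = K'" using pK(3)[OF p2(1)] pK(3)[OF p2(2)] * by simp
      have "x = x'"
      proof (rule ccontr)
        assume "x \<noteq> x'"
        then have "interior K \<inter> interior K' = {}" using tagged_division_ofD(5)[OF p p2] by auto
        then have "{Inf K<..<Sup K} = {}"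
          using KK pK(3)[OF p2(1)] by (metis inf.idem interior_atLeastAtMost_real)
        then show False using pK(5,6)[OF p2(1)] pK(5,6)[OF p2(2)] KK \<open>x \<noteq> x'\<close> by auto
      qed
      then show "x = x' \<and> K = K'" using KK by simp
    qed
    have sumP: "(\<Sum>(u, v)\<in>P. F u v) = (\<Sum>(x, K)\<in>A. F (Inf K) (Sup K))" for F :: "real \<Rightarrow> real \<Rightarrow> real"
      unfolding P_def by (subst sum.reindex[OF inj]) (auto simp: case_prod_unfold intro: sum.cong)
    have Pab: "a \<le> u \<and> u \<le> v \<and> v \<le> b" and PT: "{u<..<v} \<subseteq> T" if "(u, v) \<in> P" for u v
    proof -
      from that obtain x K where xK: "(x, K) \<in> p" "x \<in> N" "u = Inf K" "v = Sup K"
        by (auto simp: P_def A_def)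
      show "a \<le> u \<and> u \<le> v \<and> v \<le> b" using pK[OF xK(1)] xK by auto
      have "K \<subseteq> T" using fineD[OF fine xK(1)] xK(2) by (simp add: G_def)
      then show "{u<..<v} \<subseteq> T" using pK(3)[OF xK(1)] xK by (metis greaterThanLessThan_subseteq_atLeastAtMost_iff order_refl subset_trans)
    qed
    have disj: "disjoint_family_on (\<lambda>(u, v). {u<..<v}) P"
      unfolding disjoint_family_on_def
    proof (intro ballI impI)
      fix m n assume mn: "m \<in> P" "n \<in> P" "m \<noteq> n"
      then obtain x K x' K' where *: "(x, K) \<in> p" "(x', K') \<in> p"
        "m = (Inf K, Sup K)" "n = (Inf K', Sup K')"
        using Ap unfolding P_def by fast
      then have "interior K \<inter> interior K' = {}"
        using tagged_division_ofD(5)[OF p *(1,2)] mn(3) by auto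
      then show "(case m of (u, v) \<Rightarrow> {u<..<v}) \<inter> (case n of (u, v) \<Rightarrow> {u<..<v}) = {}"
        using * pK(3)[OF *(1)] pK(3)[OF *(2)] by (metis case_prod_conv interior_atLeastAtMost_real)
    qed
    have finP: "finite P" using finA by (simp add: P_def)
    have "(\<Sum>(u, v)\<in>P. v - u) = (\<Sum>i\<in>P. measure lebesgue (case i of (u, v) \<Rightarrow> {u<..<v}))"
      using Pab by (intro sum.cong) auto
    also have "\<dots> = measure lebesgue (\<Union>i\<in>P. case i of (u, v) \<Rightarrow> {u<..<v})"
      using Pab by (intro measure_finite_Union[symmetric] finP disj) (auto dest!: Pab)
    also have "\<dots> \<le> measure lebesgue T"
      using PT Tm finP by (intro measure_mono_fmeasurable) (auto intro!: sets.finite_UN)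
    finally have len: "(\<Sum>(u, v)\<in>P. v - u) < e" using mT by simp
    then have "(\<Sum>(u, v)\<in>P. norm (h v - h u)) < \<epsilon>"
      using Pab by (intro \<delta> finP disj) (auto simp: e_def)
    then have sA: "(\<Sum>(x, K)\<in>A. h (Sup K) - h (Inf K)) \<le> \<epsilon>"
      unfolding sumP
      by (smt (verit, ccfv_SIG) case_prod_unfold real_norm_def sum_mono)
    define l where "l = (\<Sum>(x, K)\<in>A. Sup K - Inf K :: real)"
    have l: "l < e" "0 \<le> l"
      using len pK Ap unfolding l_def sumP by (auto intro!: sum_nonneg)
         (meson basic_trans_rules(23) subsetD)
    have sB: "(\<Sum>(x, K)\<in>p - A. h (Sup K) - h (Inf K)) \<le> (\<Sum>(x, L)\<in>p - A. (K + \<epsilon>) * (Sup L - Inf L))"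
    proof (rule sum_mono, clarify)
      fix x L assume "(x, L) \<in> p" "(x, L) \<notin> A"
      then have xL: "(x, L) \<in> p" "x \<notin> N" by (auto simp: A_def)
      note pk = pK[OF xL(1)]
      have "x \<in> {a..b}" using pk by auto
      from rD[OF this xL(2)] obtain D where "D \<le> K" and
        D: "\<And>s. \<lbrakk>s \<in> {a..b}; \<bar>s - x\<bar> < r x\<rbrakk> \<Longrightarrow> \<bar>h s - h x - (s - x) * D\<bar> \<le> \<epsilon> * \<bar>s - x\<bar>" by blast
      have "L \<subseteq> ball x (r x)" using fineD[OF fine xL(1)] xL(2) by (simp add: G_def)
      moreover have "Inf L \<in> L" "Sup L \<in> L" using pk by (metis atLeastAtMost_iff order_trans order_refl)+
      ultimately have "\<bar>Inf L - x\<bar> < r x" "\<bar>Sup L - x\<bar> < r x"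
        by (auto simp: dist_real_def subset_eq abs_minus_commute)
      then have "\<bar>h (Inf L) - h x - (Inf L - x) * D\<bar> \<le> \<epsilon> * \<bar>Inf L - x\<bar>"
        "\<bar>h (Sup L) - h x - (Sup L - x) * D\<bar> \<le> \<epsilon> * \<bar>Sup L - x\<bar>"
        using D[of "Inf L"] D[of "Sup L"] pk(4-7) by simp_all
      \<comment> \<open>The tag lies between the end points, so the two linearization errors add up
        to exactly \<open>\<epsilon>\<close> times the length of the interval.\<close>
      then have "h (Sup L) - h (Inf L) \<le> (Sup L - x) * D - (Inf L - x) * D + \<epsilon> * (Sup L - x) + \<epsilon> * (x - Inf L)"
        using pk by (simp add: abs_le_iff)
      also have "\<dots> = (D + \<epsilon>) * (Sup L - Inf L)" by (simp add: algebra_simps)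
      also have "\<dots> \<le> (K + \<epsilon>) * (Sup L - Inf L)"
        using \<open>D \<le> K\<close> pk by (intro mult_right_mono) auto
      finally show "h (Sup L) - h (Inf L) \<le> (K + \<epsilon>) * (Sup L - Inf L)" .
    qed
    have split: "sum F p = sum F A + sum F (p - A)" for F :: "real \<times> real set \<Rightarrow> real"
      using sum.subset_diff[OF Ap finp, of F] by simp
    have "(\<Sum>(x, L)\<in>p - A. Sup L - Inf L) = (b - a) - l"
      using additive_tagged_division_1[OF \<open>a \<le> b\<close> p, of "\<lambda>t. t"] split by (simp add: l_def)
    then have "(\<Sum>(x, L)\<in>p - A. (K + \<epsilon>) * (Sup L - Inf L)) = (K + \<epsilon>) * ((b - a) - l)"
      by (simp add: sum_distrib_left[symmetric] case_prod_unfold)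
    moreover have "h b - h a = (\<Sum>(x, K)\<in>A. h (Sup K) - h (Inf K)) + (\<Sum>(x, K)\<in>p - A. h (Sup K) - h (Inf K))"
      using additive_tagged_division_1[OF \<open>a \<le> b\<close> p, of h] split by simp
    ultimately have "h b - h a \<le> \<epsilon> + (K + \<epsilon>) * ((b - a) - l)" using sA sB by linarith
    also have "\<dots> = \<epsilon> + K * (b - a) + \<epsilon> * (b - a) - K * l - \<epsilon> * l" by (simp add: algebra_simps)
    \<comment> \<open>For negative \<open>K\<close>, leaving out a total length \<open>l\<close>
      costs up to \<open>\<bar>K\<bar> * l\<close>, which is at most
      \<open>\<bar>K\<bar> * \<epsilon>\<close> by the choice of \<open>e\<close>.\<close>
    also have "\<dots> \<le> \<epsilon> + K * (b - a) + \<epsilon> * (b - a) + \<bar>K\<bar> * \<epsilon>"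
    proof -
      have "- K * l \<le> \<bar>K\<bar> * l" using l by (intro mult_right_mono) auto
      also have "\<dots> \<le> \<bar>K\<bar> * \<epsilon>" using l by (intro mult_left_mono) (auto simp: e_def)
      finally have "- K * l \<le> \<bar>K\<bar> * \<epsilon>" .
      moreover have "0 \<le> \<epsilon> * l" using l that by simp
      ultimately show ?thesis by linarith
    qed
    finally show ?thesis by (simp add: algebra_simps)
  qed
  show ?thesis
  proof (rule field_le_epsilon)
    fix e :: real assume "e > 0"
    have *: "1 + \<bar>K\<bar> + (b - a) > 0" using \<open>a \<le> b\<close> by linarith
    then show "h b - h a \<le> K * (b - a) + e"
      using eps[of "e / (1 + \<bar>K\<bar> + (b - a))"] \<open>e > 0\<close> by simp
  qed
qed

text \<open>Reduces to the scalar case by projecting on the direction of the total increment: this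
  loses nothing of the increment and cannot enlarge the derivative. For a zero increment
  \<open>sgn\<close> is zero and both sides are harmless.\<close>

lemma absolutely_continuous_norm_increment_le:
  fixes h :: "real \<Rightarrow> 'a::real_inner"
  assumes "a \<le> b" and ac: "absolutely_continuous_on_interval a b h"
    and der: "AE t in lebesgue. t \<in> {a..b} \<longrightarrow>
      (\<exists>D. norm D \<le> B \<and> (h has_vector_derivative D) (at t within {a..b}))"
  shows "norm (h b - h a) \<le> B * (b - a)"
proof -
  define w where "w = sgn (h b - h a)"
  have w: "norm w \<le> 1" by (simp add: w_def norm_sgn)
  have *: "z \<bullet> w \<le> norm z" "\<bar>z \<bullet> w\<bar> \<le> norm z" for z
  proof -
    show "\<bar>z \<bullet> w\<bar> \<le> norm z"
      by (rule order_trans[OF Cauchy_Schwarz_ineq2]) (use w in \<open>simp add: mult_left_le\<close>)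
    then show "z \<bullet> w \<le> norm z" by linarith
  qed
  have "h b \<bullet> w - h a \<bullet> w \<le> B * (b - a)"
  proof (rule absolutely_continuous_increment_le[OF \<open>a \<le> b\<close>])
    show "absolutely_continuous_on_interval a b (\<lambda>t. h t \<bullet> w)"
      using *(2) by (intro absolutely_continuous_on_interval_dominated[OF ac, of _ 1])
        (simp add: inner_diff_left[symmetric])
    show "AE t in lebesgue. t \<in> {a..b} \<longrightarrow>
      (\<exists>D\<le>B. ((\<lambda>t. h t \<bullet> w) has_vector_derivative D) (at t within {a..b}))"
      using der
    proof eventually_elim
      case (elim t)
      show ?case
      proof
        assume "t \<in> {a..b}"
        with elim obtain D where "norm D \<le> B" "(h has_vector_derivative D) (at t within {a..b})" by blast
        then show "\<exists>D\<le>B. ((\<lambda>t. h t \<bullet> w) has_vector_derivative D) (at t within {a..b})"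
          using *(1)[of D]
          by (intro exI[of _ "D \<bullet> w"])
            (auto intro: bounded_linear.has_vector_derivative[OF bounded_linear_inner_left])
      qed
    qed
  qed
  moreover have "h b \<bullet> w - h a \<bullet> w = norm (h b - h a)"
    unfolding inner_diff_left[symmetric] w_def sgn_div_norm
    by (cases "h b = h a") (auto simp: power2_norm_eq_inner[symmetric] power2_eq_square)
  ultimately show ?thesis by simp
qed

text \<open>The times at which \<open>h\<close> is outside \<open>S\<close> form a relatively open
  set. If it is nonempty, it contains a nonempty open set because \<open>a < b\<close>, and such a
  set is not null.\<close>

lemma closed_continuous_AE_imp_all:
  fixes h :: "real \<Rightarrow> 'a::topological_space"
  assumes "a < b" "continuous_on {a..b} h" "closed S"
    and ae: "AE t in lebesgue. t \<in> {a..b} \<longrightarrow> h t \<in> S"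
    and t: "t \<in> {a..b}"
  shows "h t \<in> S"
proof (rule ccontr)
  assume "h t \<notin> S"
  have "openin (top_of_set {a..b}) ({a..b} \<inter> h -` (- S))"
    using assms(2,3) by (intro continuous_openin_preimage_gen) auto
  then obtain T where T: "open T" "{a..b} \<inter> h -` (- S) = {a..b} \<inter> T"
    by (auto simp: openin_open)
  have "t \<in> {a..b} \<inter> h -` (- S)" using t \<open>h t \<notin> S\<close> by simp
  then have "t \<in> T" unfolding T(2) by simp
  moreover have "t \<in> closure {a<..<b}" using t \<open>a < b\<close> by simp
  ultimately have "T \<inter> {a<..<b} \<noteq> {}" using open_Int_closure_eq_empty[OF T(1)] by blast
  moreover have "open (T \<inter> {a<..<b})" using T(1) by auto
  ultimately have "\<not> negligible (T \<inter> {a<..<b})" using open_not_negligible by blast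
  moreover obtain N where "N \<in> null_sets lebesgue" "{t. \<not> (t \<in> {a..b} \<longrightarrow> h t \<in> S)} \<subseteq> N"
    using ae unfolding eventually_ae_filter by auto
  moreover have "T \<inter> {a<..<b} \<subseteq> {t. \<not> (t \<in> {a..b} \<longrightarrow> h t \<in> S)}" 
  proof
    fix s assume s: "s \<in> T \<inter> {a<..<b}"
    then have "s \<in> {a..b} \<inter> h -` (- S)" unfolding T(2) by auto
    then show "s \<in> {t. \<not> (t \<in> {a..b} \<longrightarrow> h t \<in> S)}" by simp
  qed
  ultimately show False
    by (meson negligible_subset negligible_iff_null_sets subset_trans)
qed

text \<open>
  Above the barrier the function decreases at least as fast as the barrier can, so it cannot
  leave the region below it.
\<close>

lemma absolutely_continuous_below_barrier:
  fixes y :: "real \<Rightarrow> real"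
  assumes ac: "absolutely_continuous_on_interval a b y" and "y a \<le> m" "0 \<le> r"
    and der: "AE t in lebesgue. t \<in> {a..b} \<longrightarrow> max c (m - r * (t - a)) < y t \<longrightarrow>
      (\<exists>D\<le>- r. (y has_vector_derivative D) (at t within {a..b}))"
    and t: "t \<in> {a..b}"
  shows "y t \<le> max c (m - r * (t - a))"
proof (rule ccontr)
  define M where "M t = max c (m - r * (t - a))" for t
  assume "\<not> y t \<le> max c (m - r * (t - a))"
  then have yt: "M t < y t" by (simp only: M_def not_le)
  have "continuous_on {a..t} y"
    using absolutely_continuous_on_interval_imp_continuous_on[OF ac] t
    by (auto elim: continuous_on_subset)
  moreover have "continuous_on {a..t} M"
    unfolding M_def by (intro continuous_intros)
  ultimately have "closed {s \<in> {a..t}. y s \<le> M s}"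
    by (intro continuous_on_closed_Collect_le) auto
  then have "compact {s \<in> {a..t}. y s \<le> M s}"
    by (rule compact_eq_bounded_closed[THEN iffD2, OF conjI, rotated])
      (auto intro: bounded_subset[OF bounded_closed_interval[of a t]])
  moreover have "a \<in> {s \<in> {a..t}. y s \<le> M s}" using t \<open>y a \<le> m\<close> by (simp add: M_def)
  \<comment> \<open>The last time up to \<open>t\<close> at which the barrier is respected; strictly
    after it the derivative bound is available.\<close>
  ultimately obtain s where s: "s \<in> {a..t}" "y s \<le> M s"
    and max: "\<And>s'. s' \<in> {a..t} \<Longrightarrow> y s' \<le> M s' \<Longrightarrow> s' \<le> s"
    using compact_attains_sup[of "{s \<in> {a..t}. y s \<le> M s}"] by blast
  have "y t - y s \<le> - r * (t - s)"
  proof (rule absolutely_continuous_increment_le)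
    show "s \<le> t" using s by simp
    show "absolutely_continuous_on_interval s t y"
      using s t by (intro absolutely_continuous_on_interval_subset[OF ac]) auto
    \<comment> \<open>At \<open>s\<close> itself the function is not above the barrier, so no
      derivative bound is known there; a single point is null.\<close>
    have "AE u in lebesgue. u \<notin> {s}"
      by (rule AE_not_in) (simp add: negligible_iff_null_sets[symmetric])
    with der show "AE u in lebesgue. u \<in> {s..t} \<longrightarrow>
      (\<exists>D\<le>- r. (y has_vector_derivative D) (at u within {s..t}))"
    proof eventually_elim
      case (elim u)
      show ?case
      proof
        assume u: "u \<in> {s..t}"
        then have "M u < y u" using max[of u] elim(2) s(1) by force
        then obtain D where "D \<le> - r" "(y has_vector_derivative D) (at u within {a..b})"
          using elim(1) u s(1) t by (auto simp: M_def)
        then show "\<exists>D\<le>- r. (y has_vector_derivative D) (at u within {s..t})"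
          using s(1) t by (intro exI[of _ D]) (auto elim!: has_vector_derivative_within_subset)
      qed
    qed
  qed
  \<comment> \<open>The barrier falls at rate at most \<open>r\<close>, its constant part not at
    all, so \<open>y\<close> cannot have overtaken it since \<open>s\<close>.\<close>
  moreover have "M s - r * (t - s) \<le> M t"
  proof -
    have "0 \<le> r * (t - s)" using s(1) \<open>0 \<le> r\<close> by simp
    moreover have "r * (t - s) = r * (t - a) - r * (s - a)" by (simp add: algebra_simps)
    ultimately show ?thesis unfolding M_def by linarith
  qed
  ultimately show False using s(2) yt by linarith
qed

section \<open>Comparison functions\<close>

lemma class_K_zero: "class_K f \<Longrightarrow> f 0 = 0"
  by (simp add: class_K_def)

lemma class_K_nonneg: "class_K f \<Longrightarrow> 0 \<le> x \<Longrightarrow> 0 \<le> f x"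
  by (auto simp: class_K_def)

lemma class_K_less: "class_K f \<Longrightarrow> 0 \<le> x \<Longrightarrow> x < y \<Longrightarrow> f x < f y"
  by (auto simp: class_K_def strict_mono_on_def)

lemma class_K_mono: "class_K f \<Longrightarrow> 0 \<le> x \<Longrightarrow> x \<le> y \<Longrightarrow> f x \<le> f y"
  using class_K_less[of f x y] by (cases "x = y") auto

lemma class_K_continuous_on_compose:
  assumes "class_K f" "continuous_on S h" "\<And>x. x \<in> S \<Longrightarrow> 0 \<le> h x"
  shows "continuous_on S (\<lambda>x. f (h x))"
proof (rule continuous_on_compose2[OF _ assms(2)])
  show "continuous_on {0..} f" using assms(1) by (simp add: class_K_def)
qed (use assms(3) in auto)

lemma class_Kinf_imp_K: "class_Kinf f \<Longrightarrow> class_K f"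
  by (simp add: class_Kinf_def)

lemma class_Kinf_iff: "class_Kinf f \<longleftrightarrow> class_K f \<and> (\<forall>y. \<exists>x\<ge>0. y < f x)"
  unfolding class_Kinf_def bdd_above_def by (auto simp: not_le)

lemma class_Kinf_id: "class_Kinf (\<lambda>x. x)"
proof -
  have "\<exists>x\<ge>0. y < x" for y :: real
    by (intro exI[of _ "\<bar>y\<bar> + 1"]) auto
  then show ?thesis
    by (simp add: class_Kinf_iff class_K_def strict_mono_on_def)
qed

lemma class_Kinf_compose:
  assumes "class_Kinf f" "class_Kinf h"
  shows "class_Kinf (\<lambda>x. f (h x))"
proof -
  have f: "class_K f" and h: "class_K h" using assms by (auto simp: class_Kinf_def)
  have "class_K (\<lambda>x. f (h x))"
    unfolding class_K_def
  proof (intro conjI)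
    show "continuous_on {0..} (\<lambda>x. f (h x))"
      using h by (intro class_K_continuous_on_compose[OF f]) (auto simp: class_K_def)
  qed (auto simp: class_K_zero[OF f] class_K_zero[OF h] strict_mono_on_def
      intro!: class_K_nonneg[OF f] class_K_nonneg[OF h] class_K_less[OF f] class_K_less[OF h])
  moreover have "\<exists>x\<ge>0. y < f (h x)" for y
  proof -
    obtain u where u: "u \<ge> 0" "y < f u" using assms(1) unfolding class_Kinf_iff by blast
    obtain x where x: "x \<ge> 0" "u < h x" using assms(2) unfolding class_Kinf_iff by blast
    show ?thesis using class_K_less[OF f u(1) x(2)] u(2) x(1) by force
  qed
  ultimately show ?thesis by (simp add: class_Kinf_iff)
qed

lemma class_Kinf_add:
  assumes "class_Kinf f" "class_Kinf h"
  shows "class_Kinf (\<lambda>x. f x + h x)"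
proof -
  have f: "class_K f" and h: "class_K h" using assms by (auto simp: class_Kinf_def)
  have "class_K (\<lambda>x. f x + h x)"
    using f h unfolding class_K_def
    by (auto simp: strict_mono_on_def image_subset_iff intro!: continuous_on_add add_strict_mono)
  moreover have "\<exists>x\<ge>0. y < f x + h x" for y
  proof -
    obtain x where x: "x \<ge> 0" "y < f x" using assms(1) unfolding class_Kinf_iff by blast
    then show ?thesis using class_K_nonneg[OF h x(1)] by force
  qed
  ultimately show ?thesis by (simp add: class_Kinf_iff)
qed

lemma class_Kinf_scale:
  assumes "class_Kinf f" "0 < c"
  shows "class_Kinf (\<lambda>x. c * f x)"
proof -
  have f: "class_K f" using assms by (auto simp: class_Kinf_def)
  have "class_K (\<lambda>x. c * f x)"
    using f \<open>0 < c\<close> unfolding class_K_def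
    by (auto simp: strict_mono_on_def image_subset_iff intro!: continuous_on_mult_left)
  moreover have "\<exists>x\<ge>0. y < c * f x" for y
  proof -
    obtain x where x: "x \<ge> 0" "y / c < f x" using assms(1) unfolding class_Kinf_iff by blast
    then show ?thesis using \<open>0 < c\<close> by (auto simp: field_simps)
  qed
  ultimately show ?thesis by (simp add: class_Kinf_iff)
qed

lemma class_Kinf_min:
  assumes "class_Kinf f" "class_Kinf h"
  shows "class_Kinf (\<lambda>x. min (f x) (h x))"
proof -
  have f: "class_K f" and h: "class_K h" using assms by (auto simp: class_Kinf_def)
  have "class_K (\<lambda>x. min (f x) (h x))"
    using f h unfolding class_K_def
    by (auto simp: strict_mono_on_def image_subset_iff min_less_iff_disj intro!: continuous_on_min)
  moreover have "\<exists>x\<ge>0. y < min (f x) (h x)" for y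
  proof -
    obtain x where x: "x \<ge> 0" "y < f x" using assms(1) unfolding class_Kinf_iff by blast
    obtain x' where x': "x' \<ge> 0" "y < h x'" using assms(2) unfolding class_Kinf_iff by blast
    have "f x \<le> f (max x x')" "h x' \<le> h (max x x')"
      using class_K_mono[OF f x(1)] class_K_mono[OF h x'(1)] by simp_all
    then show ?thesis using x x' by (intro exI[of _ "max x x'"]) auto
  qed
  ultimately show ?thesis by (simp add: class_Kinf_iff)
qed

lemma class_Kinf_inj_on: "class_Kinf f \<Longrightarrow> inj_on f {0..}"
  unfolding class_Kinf_def class_K_def by (auto intro: strict_mono_on_imp_inj_on)

lemma class_Kinf_image:
  assumes "class_Kinf f"
  shows "f ` {0..} = {0..}"
proof (intro equalityI subsetI)
  have f: "class_K f" using assms by (simp add: class_Kinf_def)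
  show "y \<in> {0..}" if "y \<in> f ` {0..}" for y using that class_K_nonneg[OF f] by auto
  fix y :: real assume "y \<in> {0..}"
  obtain x where x: "x \<ge> 0" "y < f x" using assms unfolding class_Kinf_iff by blast
  have "continuous_on {0..x} f"
    using f unfolding class_K_def by (auto elim: continuous_on_subset)
  then obtain z where "0 \<le> z" "f z = y"
    using IVT'[of f 0 y x] x \<open>y \<in> {0..}\<close> class_K_zero[OF f] by auto
  then show "y \<in> f ` {0..}" by auto
qed

lemma K_inverse_right: "class_Kinf f \<Longrightarrow> 0 \<le> y \<Longrightarrow> f (K_inverse f y) = y"
  by (rule f_inv_into_f) (simp add: class_Kinf_image)

lemma K_inverse_left: "class_Kinf f \<Longrightarrow> 0 \<le> x \<Longrightarrow> K_inverse f (f x) = x"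
  by (rule inv_into_f_f) (auto simp: class_Kinf_inj_on)

lemma class_Kinf_K_inverse:
  assumes "class_Kinf f"
  shows "class_Kinf (K_inverse f)"
proof -
  have f: "class_K f" using assms by (simp add: class_Kinf_def)
  have nonneg: "0 \<le> K_inverse f y" if "0 \<le> y" for y
    using inv_into_into[of y f "{0..}"] that by (simp add: class_Kinf_image[OF assms])
  have "class_K (K_inverse f)"
    unfolding class_K_def
  proof (intro conjI)
    show "K_inverse f ` {0..} \<subseteq> {0..}" using nonneg by auto
    show "K_inverse f 0 = 0" using K_inverse_left[OF assms, of 0] by (simp add: class_K_zero[OF f])
    show "strict_mono_on {0..} (K_inverse f)"
    proof (rule strict_mono_onI)
      fix r s :: real assume "r \<in> {0..}" "s \<in> {0..}" "r < s"
      then show "K_inverse f r < K_inverse f s"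
        using class_K_mono[OF f nonneg, of s "K_inverse f r"] K_inverse_right[OF assms, of r] K_inverse_right[OF assms, of s]
        by force
    qed
    \<comment> \<open>A continuous injection of an interval has a continuous inverse, and
      \<open>K_inverse f\<close> agrees with it on \<open>{0..}\<close>.\<close>
    obtain k where k: "homeomorphism {0..} {0..} f k"
      using homeomorphism_into_1d[of "{0..}" f "{0..}"] f class_Kinf_inj_on[OF assms] class_Kinf_image[OF assms]
      by (auto simp: class_K_def convex_imp_path_connected)
    have "K_inverse f y = k y" if "y \<in> {0..}" for y
      using that k K_inverse_left[OF assms, of "k y"] unfolding homeomorphism_def by force
    then show "continuous_on {0..} (K_inverse f)"
      using k by (simp add: homeomorphism_def cong: continuous_on_cong_simp)
  qed
  moreover have "\<exists>x\<ge>0. y < K_inverse f x" for y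
    using K_inverse_left[OF assms, of "max y 0 + 1"]
    by (intro exI[of _ "f (max y 0 + 1)"]) (simp add: class_K_nonneg[OF f])
  ultimately show ?thesis by (simp add: class_Kinf_iff)
qed

lemma le_K_inverse:
  assumes "class_Kinf f" "0 \<le> x" "f x \<le> y"
  shows "x \<le> K_inverse f y"
  using class_K_mono[OF class_Kinf_imp_K[OF class_Kinf_K_inverse[OF assms(1)]], of "f x" y]
    K_inverse_left[OF assms(1,2)] class_K_nonneg[OF class_Kinf_imp_K[OF assms(1)] assms(2)] assms(3)
  by simp

lemma class_KL_quotient:
  assumes A: "class_K A" and B: "class_K B" and "0 \<le> c"
  shows "class_KL (\<lambda>s u. A (B s / (1 + u + c)))"
  unfolding class_KL_def
proof (intro conjI allI impI)
  have nonneg: "0 \<le> B s / (1 + u + c)" if "0 \<le> s" "0 \<le> u" for s u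
    using that \<open>0 \<le> c\<close> class_K_nonneg[OF B] by simp
  show "0 \<le> A (B s / (1 + u + c))" if "0 \<le> s" "0 \<le> u" for s u
    using nonneg[OF that] by (rule class_K_nonneg[OF A])
  have "continuous_on ({0..} \<times> {0..}) (\<lambda>p. B (fst p) / (1 + snd p + c))"
    using \<open>0 \<le> c\<close> by (intro continuous_intros class_K_continuous_on_compose[OF B]) auto
  then have "continuous_on ({0..} \<times> {0..}) (\<lambda>p. A (B (fst p) / (1 + snd p + c)))"
    using nonneg by (intro class_K_continuous_on_compose[OF A]) auto
  then show "continuous_on ({0..} \<times> {0..}) (\<lambda>(s, u). A (B s / (1 + u + c)))"
    by (simp add: case_prod_unfold)
  show "class_K (\<lambda>s. A (B s / (1 + u + c)))" if "0 \<le> u" for u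
    unfolding class_K_def
  proof (intro conjI)
    show "continuous_on {0..} (\<lambda>s. A (B s / (1 + u + c)))"
    proof (rule class_K_continuous_on_compose[OF A])
      have "continuous_on {0..} B" using B by (simp add: class_K_def)
      then show "continuous_on {0..} (\<lambda>s. B s / (1 + u + c))"
        using that \<open>0 \<le> c\<close> by (intro continuous_on_divide continuous_on_const) auto
    qed (use that nonneg in auto)
    show "strict_mono_on {0..} (\<lambda>s. A (B s / (1 + u + c)))"
      using that \<open>0 \<le> c\<close> nonneg
      by (intro strict_mono_onI class_K_less[OF A] divide_strict_right_mono class_K_less[OF B]) auto
  qed (use that nonneg in \<open>auto simp: class_K_zero[OF A] class_K_zero[OF B] intro!: class_K_nonneg[OF A]\<close>)
  fix s :: real assume "0 < s"
  show "antimono_on {0..} (\<lambda>u. A (B s / (1 + u + c)))"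
    using \<open>0 < s\<close> \<open>0 \<le> c\<close> nonneg
    by (intro monotone_onI class_K_mono[OF A] divide_left_mono class_K_nonneg[OF B]) auto
  have "((\<lambda>u. B s / (1 + u + c)) \<longlongrightarrow> 0) at_top"
  proof (rule real_tendsto_divide_at_top[OF tendsto_const])
    show "filterlim (\<lambda>u. 1 + u + c) at_top at_top"
      by (rule filterlim_at_top_mono[OF filterlim_ident]) (use \<open>0 \<le> c\<close> in auto)
  qed
  moreover have "\<forall>\<^sub>F u in at_top. B s / (1 + u + c) \<in> {0..}"
    using eventually_ge_at_top[of 0] by eventually_elim (use nonneg[of s] \<open>0 < s\<close> in auto)
  moreover have "continuous (at 0 within {0..}) A"
    using A by (simp add: class_K_def continuous_on_eq_continuous_within)
  ultimately show "((\<lambda>u. A (B s / (1 + u + c))) \<longlongrightarrow> 0) at_top"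
    using continuous_within_tendsto_compose[of 0 "{0..}" A "\<lambda>u. B s / (1 + u + c)" at_top]
    by (simp add: class_K_zero[OF A])
qed

lemma class_KLL_quotient:
  assumes "class_K A" "class_K B"
  shows "class_KLL (\<lambda>s t u. A (B s / (1 + t + u)))"
  unfolding class_KLL_def
proof (intro allI impI conjI)
  fix t :: real assume "0 \<le> t"
  from class_KL_quotient[OF assms this] show "class_KL (\<lambda>s u. A (B s / (1 + u + t)))" .
  then show "class_KL (\<lambda>s u. A (B s / (1 + t + u)))" by (simp add: add.commute add.left_commute)
qed

section \<open>Smooth functions\<close>

lemma smooth_imp_C1:
  assumes "smooth h"
  shows "(h has_derivative frechet_derivative h (at x)) (at x)"
    and "continuous_on UNIV (\<lambda>x. frechet_derivative h (at x) v)"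
proof -
  have "times_differentiable (Suc 0) h" using assms by (auto simp: smooth_def)
  then show "(h has_derivative frechet_derivative h (at x)) (at x)"
    and "continuous_on UNIV (\<lambda>x. frechet_derivative h (at x) v)"
    by (auto simp: frechet_derivative_works)
qed

text \<open>\<open>smooth\<close> yields continuity of each directional derivative separately, so
  the bounds on \<open>S\<close> are taken per basis vector; their sum bounds the operator norm, and
  convexity allows the mean value inequality.\<close>

lemma smooth_Lipschitz_on_compact_convex:
  fixes h :: "'a::euclidean_space \<Rightarrow> 'b::real_normed_vector"
  assumes "smooth h" "compact S" "convex S"
  obtains L where "\<And>x y. x \<in> S \<Longrightarrow> y \<in> S \<Longrightarrow> norm (h x - h y) \<le> L * norm (x - y)"
proof -
  define D where "D x = frechet_derivative h (at x)" for x
  have der: "(h has_derivative D x) (at x)" and cont: "continuous_on UNIV (\<lambda>x. D x v)" for x v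
    unfolding D_def by (intro smooth_imp_C1 assms)+
  have "\<exists>B. \<forall>x\<in>S. norm (D x b) \<le> B" for b
  proof -
    have "compact ((\<lambda>x. D x b) ` S)"
      using cont continuous_on_subset assms(2) by (blast intro: compact_continuous_image)
    then show ?thesis using compact_imp_bounded by (force simp: bounded_iff)
  qed
  then obtain B where B: "\<And>b x. x \<in> S \<Longrightarrow> norm (D x b) \<le> B b" by metis
  have on: "onorm (D x) \<le> (\<Sum>b\<in>Basis. B b)" if "x \<in> S" for x
  proof (rule onorm_le)
    fix v
    interpret bounded_linear "D x" using der by (rule has_derivative_bounded_linear)
    have "D x v = D x (\<Sum>b\<in>Basis. (v \<bullet> b) *\<^sub>R b)" by (simp add: euclidean_representation)
    also have "\<dots> = (\<Sum>b\<in>Basis. (v \<bullet> b) *\<^sub>R D x b)" by (simp add: sum scaleR)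
    also have "norm \<dots> \<le> (\<Sum>b\<in>Basis. B b * norm v)"
    proof (rule sum_norm_le)
      fix b :: 'a assume "b \<in> Basis"
      have "norm ((v \<bullet> b) *\<^sub>R D x b) = \<bar>v \<bullet> b\<bar> * norm (D x b)" by simp
      also have "\<dots> \<le> norm v * B b"
        using Basis_le_norm[OF \<open>b \<in> Basis\<close>, of v] B[OF that, of b] by (intro mult_mono) auto
      finally show "norm ((v \<bullet> b) *\<^sub>R D x b) \<le> B b * norm v" by (simp add: mult.commute)
    qed
    finally show "norm (D x v) \<le> (\<Sum>b\<in>Basis. B b) * norm v" by (simp add: sum_distrib_right)
  qed
  show thesis
    using differentiable_bound[OF \<open>convex S\<close> has_derivative_at_withinI[OF der] on] by (rule that)
qed

lemma has_vector_derivative_chain_within: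
  assumes "(h has_vector_derivative h') (at t within S)" "(F has_derivative F') (at (h t))"
  shows "((\<lambda>t. F (h t)) has_vector_derivative F' h') (at t within S)"
proof -
  interpret F': bounded_linear F' using assms(2) by (rule has_derivative_bounded_linear)
  have "(F \<circ> h has_derivative F' \<circ> (\<lambda>u. u *\<^sub>R h')) (at t within S)"
    using diff_chain_within[OF assms(1)[unfolded has_vector_derivative_def]
        has_derivative_at_withinI[OF assms(2)]] .
  then show ?thesis by (simp add: has_vector_derivative_def comp_def F'.scaleR)
qed

section \<open>Hybrid time domains and solutions\<close>

text \<open>The definition cuts \<open>E\<close> off at \<open>(T, J)\<close> without naming the
  last index and end point of the piece. They must be \<open>J\<close> and \<open>T\<close>, since
  \<open>(T, J)\<close> belongs to the piece and nothing in it lies beyond \<open>T\<close> or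
  \<open>J\<close>.\<close>

lemma hybrid_time_domainE:
  assumes "hybrid_time_domain E" "(T, J) \<in> E"
  obtains t where "t 0 = 0" "\<And>j. j \<le> J \<Longrightarrow> t j \<le> t (Suc j)" "t (Suc J) = T"
    "\<And>s j. (s, j) \<in> E \<and> s \<le> T \<and> j \<le> J \<longleftrightarrow> j \<le> J \<and> t j \<le> s \<and> s \<le> t (Suc j)"
proof -
  have E: "E \<subseteq> {0..} \<times> UNIV" and "compact_hybrid_time_domain (E \<inter> {0..T} \<times> {..J})"
    using assms by (auto simp: hybrid_time_domain_def)
  then obtain J' t where t: "t 0 = 0" "\<And>j. j \<le> J' \<Longrightarrow> t j \<le> t (Suc j)"
    "E \<inter> {0..T} \<times> {..J} = (\<Union>j\<le>J'. {t j..t (Suc j)} \<times> {j})"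
    unfolding compact_hybrid_time_domain_def by blast
  have iff: "(s, j) \<in> E \<and> s \<le> T \<and> j \<le> J \<longleftrightarrow> j \<le> J' \<and> t j \<le> s \<and> s \<le> t (Suc j)" for s j
  proof -
    have "(s, j) \<in> E \<and> s \<le> T \<and> j \<le> J \<longleftrightarrow> (s, j) \<in> E \<inter> {0..T} \<times> {..J}" using E by auto
    then show ?thesis unfolding t(3) by auto
  qed
  have TJ: "J \<le> J'" "t J \<le> T" "T \<le> t (Suc J)" using iff[of T J] assms(2) by auto
  have "J' \<le> J" using iff[of "t J'" J'] t(2)[of J'] by simp
  then have [simp]: "J' = J" using TJ by simp
  have "t (Suc J) \<le> T" using iff[of "t (Suc J)" J] t(2)[of J] by simp
  then show thesis using that[of t] t(1,2) iff TJ by simp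
qed

lemma hybrid_time_domain_origin:
  assumes "hybrid_time_domain E" "(T, J) \<in> E"
  shows "(0, 0) \<in> E" "0 \<le> T"
proof -
  obtain t where t: "t 0 = 0" "\<And>j. j \<le> J \<Longrightarrow> t j \<le> t (Suc j)" "t (Suc J) = T"
    "\<And>s j. (s, j) \<in> E \<and> s \<le> T \<and> j \<le> J \<longleftrightarrow> j \<le> J \<and> t j \<le> s \<and> s \<le> t (Suc j)"
    using hybrid_time_domainE[OF assms] by metis
  show "(0, 0) \<in> E" using t(1) t(2)[of 0] t(4)[of 0 0] by simp
  show "0 \<le> T" using assms by (auto simp: hybrid_time_domain_def)
qed

text \<open>With \<open>t\<close> the break points, \<open>(s, j) \<in> E\<close> gives
  \<open>s \<le> t (Suc j)\<close> and \<open>(s', Suc j) \<in> E\<close> gives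
  \<open>t (Suc j) \<le> s'\<close>. The slice of index \<open>Suc j\<close> is an interval
  containing both times.\<close>

lemma successive_jump_times:
  assumes E: "hybrid_time_domain E" and jumps: "jump_time E j s" "jump_time E (Suc j) s'"
  shows "s \<le> s'" "{s..s'} \<times> {Suc j} \<subseteq> E"
proof -
  have mem: "(s, j) \<in> E" "(s, Suc j) \<in> E" "(s', Suc j) \<in> E" "(s', Suc (Suc j)) \<in> E"
    using jumps by (auto simp: jump_time_def)
  show "s \<le> s'"
  proof (rule ccontr)
    assume "\<not> s \<le> s'"
    obtain t where "\<And>r i. (r, i) \<in> E \<and> r \<le> s \<and> i \<le> Suc j \<longleftrightarrow> i \<le> Suc j \<and> t i \<le> r \<and> r \<le> t (Suc i)"
      using hybrid_time_domainE[OF E mem(2)] by metis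
    from this[of s j] this[of s' "Suc j"] show False using mem \<open>\<not> s \<le> s'\<close> by simp
  qed
  obtain t where t: "\<And>r i. (r, i) \<in> E \<and> r \<le> s' \<and> i \<le> Suc (Suc j) \<longleftrightarrow>
      i \<le> Suc (Suc j) \<and> t i \<le> r \<and> r \<le> t (Suc i)"
    using hybrid_time_domainE[OF E mem(4)] by metis
  show "{s..s'} \<times> {Suc j} \<subseteq> E"
  proof clarify
    fix r assume "r \<in> {s..s'}"
    then show "(r, Suc j) \<in> E"
      using t[of r "Suc j"] t[of s "Suc j"] t[of s' "Suc j"] mem \<open>s \<le> s'\<close> by auto
  qed
qed

lemma hybrid_solution_flow:
  assumes sol: "hybrid_solution H E \<phi>" and sub: "{a..b} \<times> {j} \<subseteq> E" and "a \<le> b"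
  shows "absolutely_continuous_on_interval a b (\<lambda>t. \<phi> t j)"
    and "AE t in lebesgue. t \<in> {a..b} \<longrightarrow> \<phi> t j \<in> flow_set H \<and>
      ((\<lambda>t. \<phi> t j) has_vector_derivative flow_map H (\<phi> t j)) (at t within {a..b})"
proof -
  have sub': "{a..b} \<subseteq> {t. (t, j) \<in> E}" using sub by auto
  with sol \<open>a \<le> b\<close> show "absolutely_continuous_on_interval a b (\<lambda>t. \<phi> t j)"
    unfolding hybrid_solution_def hybrid_arc_def locally_absolutely_continuous_on_def by blast
  have "AE t in lebesgue. (t, j) \<in> E \<longrightarrow> \<phi> t j \<in> flow_set H \<and>
      ((\<lambda>s. \<phi> s j) has_vector_derivative flow_map H (\<phi> t j)) (at t within {s. (s, j) \<in> E})"
    using sol by (simp add: hybrid_solution_def)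
  then show "AE t in lebesgue. t \<in> {a..b} \<longrightarrow> \<phi> t j \<in> flow_set H \<and>
      ((\<lambda>t. \<phi> t j) has_vector_derivative flow_map H (\<phi> t j)) (at t within {a..b})"
  proof eventually_elim
    case (elim t)
    then show ?case using sub' has_vector_derivative_within_subset[OF _ sub'] by blast
  qed
qed

section \<open>The event-triggered control system\<close>

lemma norm_components_le: "norm (fst q) \<le> norm q" "norm (snd q) \<le> norm q"
  using norm_fst_le[of "fst q" "snd q"] norm_snd_le[of "snd q" "fst q"] by simp_all

locale event_triggered =
  fixes f :: "'x::euclidean_space \<times> 'e::euclidean_space \<Rightarrow> 'x"
    and g :: "'x \<times> 'e \<Rightarrow> 'e"
    and \<delta> \<alpha>V_low \<alpha>V_up \<alpha> \<gamma> :: "real \<Rightarrow> real"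
    and \<sigma> :: real
    and V :: "'x \<Rightarrow> real"
  assumes \<delta>: "class_Kinf \<delta>"
    and \<sigma>: "0 < \<sigma>" "\<sigma> < 1"
    and V_smooth: "smooth V"
    and Kinf: "class_Kinf \<alpha>V_low" "class_Kinf \<alpha>V_up" "class_Kinf \<alpha>" "class_Kinf \<gamma>"
    and V_bounds: "\<And>x. \<alpha>V_low (norm x) \<le> V x" "\<And>x. V x \<le> \<alpha>V_up (norm x)"
    and V_flow: "\<And>x e. frechet_derivative V (at x) (f (x, e)) \<le> - \<alpha> (V x) + \<gamma> (norm e)"
    and f_growth: "\<And>S. compact S \<Longrightarrow> \<exists>L1\<ge>0. \<exists>L2\<ge>0. \<forall>(x, e)\<in>S.
        norm (f (x, e)) \<le> L1 * (norm x + norm e) \<and>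
        K_inverse \<alpha>V_low (gamma_tilde \<sigma> \<alpha> \<gamma> (norm e)) \<le> L2 * norm e"
    and g_growth: "\<And>S. compact S \<Longrightarrow> \<exists>L3\<ge>0. \<forall>(x, e)\<in>S.
        norm (g (x, e)) \<le> L3 * (norm x + norm e)"
begin

section \<open>Energy function and its comparison with the norm\<close>

abbreviation W :: "'e \<Rightarrow> real" where
  "W \<equiv> \<lambda>e. gamma_tilde \<sigma> \<alpha> \<gamma> (norm e)"

abbreviation H :: "('x \<times> 'e \<times> real) hybrid_system" where
  "H \<equiv> event_triggered_system f g \<delta> V W"

text \<open>On the flow set this is just \<open>max (V x) \<eta>\<close>. The absolute value and
  \<open>W e\<close> make it control the norm everywhere: a solution whose domain is a single point
  may sit outside both sets, even with negative \<open>\<eta>\<close>.\<close>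

definition energy :: "'x \<times> 'e \<times> real \<Rightarrow> real" where
  "energy = (\<lambda>(x, e, \<eta>). max (V x) (max \<bar>\<eta>\<bar> (W e)))"

definition decay :: "real \<Rightarrow> real" where
  "decay u = min ((1 - \<sigma>) * \<alpha> u) (\<delta> u)"

text \<open>The summands recover the sizes of \<open>x\<close>, \<open>e\<close> and
  \<open>\<eta>\<close>, in this order, from the energy.\<close>

definition norm_bound :: "real \<Rightarrow> real" where
  "norm_bound u = K_inverse \<alpha>V_low u + K_inverse (gamma_tilde \<sigma> \<alpha> \<gamma>) u + u"

definition energy_bound :: "real \<Rightarrow> real" where
  "energy_bound r = \<alpha>V_up r + r + gamma_tilde \<sigma> \<alpha> \<gamma> r"

lemma class_Kinf_gamma_tilde: "class_Kinf (gamma_tilde \<sigma> \<alpha> \<gamma>)"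
proof -
  have "class_Kinf (\<lambda>s. K_inverse \<alpha> (inverse \<sigma> * \<gamma> s))"
    using class_Kinf_compose[OF class_Kinf_K_inverse[OF Kinf(3)] class_Kinf_scale[OF Kinf(4)]] \<sigma> by simp
  then show ?thesis by (simp add: gamma_tilde_def[abs_def])
qed

lemma class_K_gamma_tilde: "class_K (gamma_tilde \<sigma> \<alpha> \<gamma>)"
  by (rule class_Kinf_imp_K[OF class_Kinf_gamma_tilde])

lemma class_Kinf_decay: "class_Kinf decay"
  unfolding decay_def[abs_def] using class_Kinf_min[OF class_Kinf_scale[OF Kinf(3)] \<delta>] \<sigma> by simp

lemma class_Kinf_norm_bound: "class_Kinf norm_bound"
  unfolding norm_bound_def[abs_def]
  by (rule class_Kinf_add[OF class_Kinf_add[OF class_Kinf_K_inverse[OF Kinf(1)]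
        class_Kinf_K_inverse[OF class_Kinf_gamma_tilde]] class_Kinf_id])

lemma class_Kinf_energy_bound: "class_Kinf energy_bound"
  unfolding energy_bound_def[abs_def]
  by (rule class_Kinf_add[OF class_Kinf_add[OF Kinf(2) class_Kinf_id] class_Kinf_gamma_tilde])

lemma V_nonneg: "0 \<le> V x"
  using class_K_nonneg[OF class_Kinf_imp_K[OF Kinf(1)], of "norm x"] V_bounds(1)[of x] by simp

lemma W_nonneg: "0 \<le> W e"
  by (rule class_K_nonneg[OF class_K_gamma_tilde]) simp

lemma W_zero: "W 0 = 0"
  by (simp add: class_K_zero[OF class_K_gamma_tilde])

lemma energy_nonneg: "0 \<le> energy q"
  by (auto simp: energy_def V_nonneg split: prod.split intro: max.coboundedI1)

lemma continuous_on_V: "continuous_on UNIV V"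
  using smooth_imp_C1(1)[OF V_smooth]
  by (auto intro!: continuous_at_imp_continuous_on has_derivative_continuous)

lemma continuous_on_W: "continuous_on UNIV W"
  by (rule class_K_continuous_on_compose[OF class_K_gamma_tilde])
    (auto intro: continuous_intros)

lemma mem_flow_set:
  "q \<in> flow_set H \<longleftrightarrow> W (fst (snd q)) \<le> max (V (fst q)) (snd (snd q)) \<and> 0 \<le> snd (snd q)"
  by (auto simp: event_triggered_system_def)

lemma flow_map_components:
  "fst (flow_map H q) = f (fst q, fst (snd q))"
  "fst (snd (flow_map H q)) = g (fst q, fst (snd q))"
  "snd (snd (flow_map H q)) = - \<delta> (snd (snd q))"
  by (auto simp: event_triggered_system_def split: prod.split)

lemma energy_components:
  "energy q = max (V (fst q)) (max \<bar>snd (snd q)\<bar> (W (fst (snd q))))"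
  by (auto simp: energy_def split: prod.split)

lemma closed_flow_set: "closed (flow_set H)"
proof -
  have V: "continuous_on UNIV (\<lambda>q :: 'x \<times> 'e \<times> real. V (fst q))"
    by (intro continuous_on_compose2[OF continuous_on_V] continuous_intros) auto
  have W: "continuous_on UNIV (\<lambda>q :: 'x \<times> 'e \<times> real. W (fst (snd q)))"
    by (intro continuous_on_compose2[OF continuous_on_W] continuous_intros) auto
  have "flow_set H = {q. W (fst (snd q)) \<le> max (V (fst q)) (snd (snd q))} \<inter> {q. 0 \<le> snd (snd q)}"
    using mem_flow_set by auto
  also have "closed \<dots>"
    by (intro closed_Int closed_Collect_le continuous_on_max V W continuous_intros)
  finally show ?thesis .
qed

lemma norm_le_norm_bound: "norm q \<le> norm_bound (energy q)"
proof -
  have q: "norm q \<le> norm (fst q) + norm (fst (snd q)) + \<bar>snd (snd q)\<bar>"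
    using norm_Pair_le[of "fst q" "snd q"] norm_Pair_le[of "fst (snd q)" "snd (snd q)"] by simp
  have "\<alpha>V_low (norm (fst q)) \<le> energy q"
    using V_bounds(1)[of "fst q"] by (simp add: energy_components le_max_iff_disj)
  then have "norm (fst q) \<le> K_inverse \<alpha>V_low (energy q)"
    by (intro le_K_inverse Kinf) auto
  moreover have "norm (fst (snd q)) \<le> K_inverse (gamma_tilde \<sigma> \<alpha> \<gamma>) (energy q)"
    by (intro le_K_inverse class_Kinf_gamma_tilde) (auto simp: energy_components)
  moreover have "\<bar>snd (snd q)\<bar> \<le> energy q" by (simp add: energy_components)
  ultimately show ?thesis using q unfolding norm_bound_def by linarith
qed

lemma energy_le_energy_bound: "energy q \<le> energy_bound (norm q)"
proof -
  note n = norm_components_le[of q]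
  have n': "norm (fst (snd q)) \<le> norm q" "\<bar>snd (snd q)\<bar> \<le> norm q"
    using n(2) norm_components_le[of "snd q"] by auto
  have "\<alpha>V_up (norm (fst q)) \<le> \<alpha>V_up (norm q)"
    by (intro class_K_mono[OF class_Kinf_imp_K[OF Kinf(2)]] n) simp
  then have "V (fst q) \<le> \<alpha>V_up (norm q)" using V_bounds(2)[of "fst q"] by linarith
  moreover have "W (fst (snd q)) \<le> gamma_tilde \<sigma> \<alpha> \<gamma> (norm q)"
    by (intro class_K_mono[OF class_K_gamma_tilde] n') simp
  moreover have "0 \<le> \<alpha>V_up (norm q)" "0 \<le> gamma_tilde \<sigma> \<alpha> \<gamma> (norm q)"
    using class_K_nonneg[OF class_Kinf_imp_K[OF Kinf(2)]] class_K_nonneg[OF class_K_gamma_tilde] by simp_all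
  ultimately show ?thesis using n' norm_ge_zero[of q] unfolding energy_components energy_bound_def by linarith
qed

lemma energy_le_0_imp: "energy q \<le> 0 \<Longrightarrow> q = 0"
  using norm_le_norm_bound[of q] energy_nonneg[of q] class_K_zero[OF class_Kinf_imp_K[OF class_Kinf_norm_bound]]
  by simp

lemma energy_zero: "energy 0 = 0"
  using energy_le_energy_bound[of 0] energy_nonneg[of 0] class_K_zero[OF class_Kinf_imp_K[OF class_Kinf_energy_bound]]
  by simp

section \<open>Decay of the energy along solutions\<close>

text \<open>
  On the flow set the error is dominated by whichever of \<open>V x\<close> and \<open>\<eta>\<close> is larger. Hence \<open>V x\<close>
  decreases at rate \<open>(1 - \<sigma>) * \<alpha>\<close> wherever it exceeds \<open>\<eta>\<close>, while \<open>\<eta>\<close> decreases by itself.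
\<close>

lemma flow_energy:
  fixes \<phi> :: "real \<Rightarrow> 'x \<times> 'e \<times> real"
  assumes "a \<le> b" "0 \<le> c" and ac: "absolutely_continuous_on_interval a b \<phi>"
    and flow: "AE t in lebesgue. t \<in> {a..b} \<longrightarrow> \<phi> t \<in> flow_set H \<and>
      (\<phi> has_vector_derivative flow_map H (\<phi> t)) (at t within {a..b})"
  shows "energy (\<phi> b) \<le> max c (energy (\<phi> a) - decay c * (b - a))"
proof (cases "a = b")
  case False
  then have "a < b" using \<open>a \<le> b\<close> by simp
  define x where "x t = fst (\<phi> t)" for t
  define e where "e t = fst (snd (\<phi> t))" for t
  define \<eta> where "\<eta> t = snd (snd (\<phi> t))" for t
  define m where "m = energy (\<phi> a)"
  have decay_c: "0 \<le> decay c"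
    using class_K_nonneg[OF class_Kinf_imp_K[OF class_Kinf_decay] \<open>0 \<le> c\<close>] .
  \<comment> \<open>Closedness of the flow set gives membership at every time, in particular at
    \<open>b\<close>, where \<open>W e\<close> then drops out of the energy.\<close>
  have "AE t in lebesgue. t \<in> {a..b} \<longrightarrow> \<phi> t \<in> flow_set H"
    using flow by eventually_elim blast
  then have mem: "\<phi> t \<in> flow_set H" if "t \<in> {a..b}" for t
    using closed_continuous_AE_imp_all[OF \<open>a < b\<close> _ closed_flow_set _ that]
      absolutely_continuous_on_interval_imp_continuous_on[OF ac] by blast
  have xy: "norm (x v - x u) \<le> norm (\<phi> v - \<phi> u)" "\<bar>\<eta> v - \<eta> u\<bar> \<le> norm (\<phi> v - \<phi> u)" for u v
    using norm_components_le[of "\<phi> v - \<phi> u"] norm_components_le(2)[of "snd (\<phi> v - \<phi> u)"]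
    by (auto simp: x_def \<eta>_def)
  have ac_x: "absolutely_continuous_on_interval a b x"
    using xy(1) by (intro absolutely_continuous_on_interval_dominated[OF ac, of _ 1]) simp
  have ac_\<eta>: "absolutely_continuous_on_interval a b \<eta>"
    using xy(2) by (intro absolutely_continuous_on_interval_dominated[OF ac, of _ 1]) simp
  \<comment> \<open>\<open>V\<close> is Lipschitz on balls only, so the compactness of the
    trajectory piece is needed first.\<close>
  have ac_V: "absolutely_continuous_on_interval a b (\<lambda>t. V (x t))"
  proof -
    have "compact (x ` {a..b})"
      by (intro compact_continuous_image absolutely_continuous_on_interval_imp_continuous_on[OF ac_x]) simp
    from compact_imp_bounded[OF this] have "\<exists>R. \<forall>z\<in>x ` {a..b}. norm z \<le> R"
      by (simp only: bounded_iff)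
    then obtain R where R: "\<And>t. t \<in> {a..b} \<Longrightarrow> norm (x t) \<le> R" by blast
    obtain L where "\<And>y z. y \<in> cball 0 R \<Longrightarrow> z \<in> cball 0 R \<Longrightarrow> norm (V y - V z) \<le> L * norm (y - z)"
      using smooth_Lipschitz_on_compact_convex[OF V_smooth compact_cball convex_cball] by metis
    then show ?thesis
      using R by (intro absolutely_continuous_on_interval_dominated[OF ac_x, of _ L]) auto
  qed
  \<comment> \<open>\<open>\<eta>\<close> comes first because its equation is autonomous;
    afterwards, \<open>V x\<close> above the barrier means \<open>V x\<close> above
    \<open>\<eta>\<close>.\<close>
  have \<eta>_le: "\<eta> t \<le> max c (m - decay c * (t - a))" if "t \<in> {a..b}" for t
  proof (rule absolutely_continuous_below_barrier[OF ac_\<eta> _ decay_c _ that])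
    show "\<eta> a \<le> m" unfolding m_def energy_components \<eta>_def by linarith
    show "AE t in lebesgue. t \<in> {a..b} \<longrightarrow> max c (m - decay c * (t - a)) < \<eta> t \<longrightarrow>
      (\<exists>D\<le>- decay c. (\<eta> has_vector_derivative D) (at t within {a..b}))"
      using flow
    proof eventually_elim
      case (elim t)
      show ?case
      proof (intro impI exI conjI)
        assume t: "t \<in> {a..b}" and gt: "max c (m - decay c * (t - a)) < \<eta> t"
        have "\<delta> c \<le> \<delta> (\<eta> t)"
          using gt by (intro class_K_mono[OF class_Kinf_imp_K[OF \<delta>] \<open>0 \<le> c\<close>]) simp
        then show "- \<delta> (\<eta> t) \<le> - decay c" by (simp add: decay_def)
        from elim t have "(\<phi> has_vector_derivative flow_map H (\<phi> t)) (at t within {a..b})" by blast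
        then have "((\<lambda>t. snd (snd (\<phi> t))) has_vector_derivative snd (snd (flow_map H (\<phi> t)))) (at t within {a..b})"
          by (intro bounded_linear.has_vector_derivative[OF bounded_linear_snd])
        then show "(\<eta> has_vector_derivative - \<delta> (\<eta> t)) (at t within {a..b})"
          by (simp add: flow_map_components \<eta>_def[abs_def])
      qed
    qed
  qed
  have V_le: "V (x t) \<le> max c (m - decay c * (t - a))" if "t \<in> {a..b}" for t
  proof (rule absolutely_continuous_below_barrier[OF ac_V _ decay_c _ that])
    show "V (x a) \<le> m" by (simp add: m_def energy_components x_def)
    show "AE t in lebesgue. t \<in> {a..b} \<longrightarrow> max c (m - decay c * (t - a)) < V (x t) \<longrightarrow>
      (\<exists>D\<le>- decay c. ((\<lambda>t. V (x t)) has_vector_derivative D) (at t within {a..b}))"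
      using flow
    proof eventually_elim
      case (elim t)
      show ?case
      proof (intro impI exI conjI)
        assume t: "t \<in> {a..b}" and gt: "max c (m - decay c * (t - a)) < V (x t)"
        have "W (e t) \<le> V (x t)"
          using mem[OF t] \<eta>_le[OF t] gt by (auto simp: mem_flow_set x_def e_def \<eta>_def)
        then have "\<alpha> (W (e t)) \<le> \<alpha> (V (x t))"
          by (intro class_K_mono[OF class_Kinf_imp_K[OF Kinf(3)] W_nonneg])
        \<comment> \<open>The purpose of \<open>gamma_tilde\<close>: domination of
          \<open>W e\<close> by \<open>V x\<close> bounds the disturbance term by
          \<open>\<sigma> * \<alpha> (V x)\<close>, leaving the fraction \<open>1 - \<sigma>\<close>
          of the decay.\<close>
        moreover have "\<alpha> (W (e t)) = inverse \<sigma> * \<gamma> (norm (e t))"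
          unfolding gamma_tilde_def using \<sigma>
          by (intro K_inverse_right[OF Kinf(3)] mult_nonneg_nonneg class_K_nonneg[OF class_Kinf_imp_K[OF Kinf(4)]]) auto
        ultimately have "\<gamma> (norm (e t)) \<le> \<sigma> * \<alpha> (V (x t))" using \<sigma> by (simp add: field_simps)
        then have "frechet_derivative V (at (x t)) (f (x t, e t)) \<le> - ((1 - \<sigma>) * \<alpha> (V (x t)))"
          using V_flow[of "x t" "e t"] by (simp add: algebra_simps)
        moreover have "(1 - \<sigma>) * \<alpha> c \<le> (1 - \<sigma>) * \<alpha> (V (x t))"
          using gt \<sigma> by (intro mult_left_mono class_K_mono[OF class_Kinf_imp_K[OF Kinf(3)] \<open>0 \<le> c\<close>]) auto
        ultimately show "frechet_derivative V (at (x t)) (f (x t, e t)) \<le> - decay c"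
          unfolding decay_def by linarith
        from elim t have "(\<phi> has_vector_derivative flow_map H (\<phi> t)) (at t within {a..b})" by blast
        then have "((\<lambda>t. fst (\<phi> t)) has_vector_derivative fst (flow_map H (\<phi> t))) (at t within {a..b})"
          by (intro bounded_linear.has_vector_derivative[OF bounded_linear_fst])
        then have "(x has_vector_derivative f (x t, e t)) (at t within {a..b})"
          by (simp add: flow_map_components x_def[abs_def] e_def)
        then show "((\<lambda>t. V (x t)) has_vector_derivative frechet_derivative V (at (x t)) (f (x t, e t)))
            (at t within {a..b})"
          by (rule has_vector_derivative_chain_within[OF _ smooth_imp_C1(1)[OF V_smooth]])
      qed
    qed
  qed
  have "b \<in> {a..b}" using \<open>a \<le> b\<close> by simp
  from mem[OF this] have "energy (\<phi> b) = max (V (x b)) (\<eta> b)"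
    by (auto simp: mem_flow_set energy_components x_def \<eta>_def)
  then show ?thesis using V_le[of b] \<eta>_le[of b] \<open>a \<le> b\<close> by (simp add: m_def)
qed simp

text \<open>The state \<open>x\<close> is kept, \<open>e\<close> is reset, and the new
  \<open>\<eta>\<close> is the old \<open>W e\<close>, which the energy already contains.\<close>

lemma jump_energy:
  assumes "hybrid_solution H E \<phi>" "(t, j) \<in> E" "(t, Suc j) \<in> E"
  shows "energy (\<phi> t (Suc j)) \<le> energy (\<phi> t j)"
proof -
  obtain x e \<eta> where q: "\<phi> t j = (x, e, \<eta>)" by (cases "\<phi> t j")
  have "\<phi> t (Suc j) = jump_map H (\<phi> t j)"
    using assms by (auto simp: hybrid_solution_def)
  then have "\<phi> t (Suc j) = (x, 0, W e)" by (simp add: q event_triggered_system_def)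
  then show ?thesis using W_nonneg[of e] W_zero V_nonneg[of x] by (simp add: energy_def q)
qed

text \<open>Bounds of the form \<open>max c (m - r * t)\<close> concatenate: continuing from a value
  below such a bound simply adds the elapsed times. The start is an arbitrary point of the domain so
  that the bound can be restarted where the state vanishes.\<close>

lemma solution_energy:
  assumes sol: "hybrid_solution H E \<phi>" and mem: "(s, i) \<in> E" "(T, J) \<in> E"
    and "s \<le> T" "i \<le> J" "0 \<le> c"
  shows "energy (\<phi> T J) \<le> max c (energy (\<phi> s i) - decay c * (T - s))"
proof -
  have htd: "hybrid_time_domain E" using sol by (simp add: hybrid_solution_def hybrid_arc_def)
  obtain t where t: "\<And>j. j \<le> J \<Longrightarrow> t j \<le> t (Suc j)" "t (Suc J) = T"
    "\<And>r j. (r, j) \<in> E \<and> r \<le> T \<and> j \<le> J \<longleftrightarrow> j \<le> J \<and> t j \<le> r \<and> r \<le> t (Suc j)"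
    using hybrid_time_domainE[OF htd mem(2)] by metis
  have decay_c: "0 \<le> decay c"
    using class_K_nonneg[OF class_Kinf_imp_K[OF class_Kinf_decay] \<open>0 \<le> c\<close>] .
  have flow: "energy (\<phi> r' k) \<le> max c (energy (\<phi> r k) - decay c * (r' - r))"
    if "k \<le> J" "t k \<le> r" "r \<le> r'" "r' \<le> t (Suc k)" for r r' k
  proof -
    have "{r..r'} \<times> {k} \<subseteq> E"
    proof clarify
      fix u assume "u \<in> {r..r'}"
      then show "(u, k) \<in> E" using t(3)[of u k] that by simp
    qed
    from hybrid_solution_flow[OF sol this \<open>r \<le> r'\<close>] show ?thesis
      using \<open>r \<le> r'\<close> \<open>0 \<le> c\<close> by (intro flow_energy)
  qed
  have s: "t i \<le> s" "s \<le> t (Suc i)" using t(3)[of s i] mem(1) \<open>s \<le> T\<close> \<open>i \<le> J\<close> by auto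
  \<comment> \<open>Covering all \<open>r\<close> in interval \<open>k\<close> passes the bound to
    its right end, where the next jump takes place. The condition \<open>s \<le> r\<close> matters
    for interval \<open>i\<close>, which may begin before \<open>s\<close>.\<close>
  have "k \<le> J \<longrightarrow> s \<le> t (Suc k) \<and> (\<forall>r. s \<le> r \<and> t k \<le> r \<and> r \<le> t (Suc k) \<longrightarrow>
      energy (\<phi> r k) \<le> max c (energy (\<phi> s i) - decay c * (r - s)))" if "i \<le> k" for k
    using that
  proof (induction k rule: dec_induct)
    case base
    show ?case using s flow[of i s] by simp
  next
    case (step k)
    show ?case
    proof
      assume k: "Suc k \<le> J"
      define r0 where "r0 = t (Suc k)"
      have r0: "s \<le> r0" "energy (\<phi> r0 k) \<le> max c (energy (\<phi> s i) - decay c * (r0 - s))"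
        using step.IH k t(1)[of k] by (auto simp: r0_def)
      have "(r0, k) \<in> E" "(r0, Suc k) \<in> E"
        using t(3)[of r0 k] t(3)[of r0 "Suc k"] t(1)[of k] t(1)[of "Suc k"] k by (auto simp: r0_def)
      from jump_energy[OF sol this] r0(2)
      have jump: "energy (\<phi> r0 (Suc k)) \<le> max c (energy (\<phi> s i) - decay c * (r0 - s))" by linarith
      have "energy (\<phi> r (Suc k)) \<le> max c (energy (\<phi> s i) - decay c * (r - s))"
        if "r0 \<le> r" "r \<le> t (Suc (Suc k))" for r
      proof -
        have "energy (\<phi> r (Suc k)) \<le> max c (energy (\<phi> r0 (Suc k)) - decay c * (r - r0))"
          using flow[of "Suc k" r0 r] k that by (simp add: r0_def)
        moreover have "0 \<le> decay c * (r - r0)" using decay_c that by simp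
        moreover have "decay c * (r - s) = decay c * (r - r0) + decay c * (r0 - s)"
          by (simp add: algebra_simps)
        ultimately show ?thesis using jump by linarith
      qed
      then show "s \<le> t (Suc (Suc k)) \<and> (\<forall>r. s \<le> r \<and> t (Suc k) \<le> r \<and> r \<le> t (Suc (Suc k)) \<longrightarrow>
          energy (\<phi> r (Suc k)) \<le> max c (energy (\<phi> s i) - decay c * (r - s)))"
        using r0(1) t(1)[OF k] by (auto simp: r0_def)
    qed
  qed
  from this[OF \<open>i \<le> J\<close>] show ?thesis using t(1)[of J] t(2) \<open>s \<le> T\<close> by auto
qed

text \<open>At level \<open>c = 0\<close> the rate \<open>decay c\<close> is zero, and the energy
  estimate says that the energy does not increase.\<close>

lemma solution_stays_zero:
  assumes "hybrid_solution H E \<phi>" "(s, i) \<in> E" "(T, J) \<in> E" "s \<le> T" "i \<le> J" "\<phi> s i = 0"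
  shows "\<phi> T J = 0"
  using solution_energy[OF assms(1-5) order_refl] assms(6) class_K_zero[OF class_Kinf_imp_K[OF class_Kinf_decay]]
  by (intro energy_le_0_imp) (simp add: energy_zero)

text \<open>With \<open>s\<close> the initial energy and \<open>c\<close> the claimed bound,
  \<open>decay c * (1 + T) = decay s + s\<close>. If \<open>d = s - decay c * T\<close> exceeded
  \<open>c\<close>, then \<open>d * (1 + T) = s - T * decay s\<close> would be positive, so
  \<open>decay s \<le> decay c < decay d \<le> decay s\<close>. The summand \<open>decay s\<close>
  in the numerator covers small \<open>T\<close>.\<close>

lemma solution_energy_rate:
  assumes sol: "hybrid_solution H E \<phi>" and mem: "(T, J) \<in> E"
  shows "energy (\<phi> T J) \<le>
    K_inverse decay ((decay (energy (\<phi> 0 0)) + energy (\<phi> 0 0)) / (1 + T))"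
proof -
  have htd: "hybrid_time_domain E" using sol by (simp add: hybrid_solution_def hybrid_arc_def)
  note origin = hybrid_time_domain_origin[OF htd mem]
  define s where "s = energy (\<phi> 0 0)"
  define c where "c = K_inverse decay ((decay s + s) / (1 + T))"
  note K = class_Kinf_imp_K[OF class_Kinf_decay]
  have s: "0 \<le> s" "0 \<le> decay s" using energy_nonneg class_K_nonneg[OF K] by (auto simp: s_def)
  then have nonneg: "0 \<le> (decay s + s) / (1 + T)" using origin by simp
  have "0 \<le> c" unfolding c_def
    by (rule class_K_nonneg[OF class_Kinf_imp_K[OF class_Kinf_K_inverse[OF class_Kinf_decay]] nonneg])
  have dc: "decay c = (decay s + s) / (1 + T)"
    unfolding c_def by (rule K_inverse_right[OF class_Kinf_decay nonneg])
  have "s - decay c * T \<le> c"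
  proof (rule ccontr)
    assume "\<not> s - decay c * T \<le> c"
    define d where "d = s - decay c * T"
    have d: "c < d" using \<open>\<not> _\<close> by (simp add: d_def)
    have "0 \<le> decay c * T" using origin s by (simp add: dc)
    then have "d \<le> s" by (simp add: d_def)
    have eq: "d * (1 + T) = s - T * decay s"
      using origin by (simp add: d_def dc field_simps)
    have "0 < d * (1 + T)" using d \<open>0 \<le> c\<close> origin by (intro mult_pos_pos) auto
    then have "decay s * (1 + T) \<le> decay s + s" using eq by (simp add: algebra_simps)
    then have "decay s \<le> decay c" using origin by (simp add: dc field_simps)
    also have "\<dots> < decay d" by (rule class_K_less[OF K \<open>0 \<le> c\<close> d])
    also have "\<dots> \<le> decay s" using d \<open>0 \<le> c\<close> by (intro class_K_mono[OF K] \<open>d \<le> s\<close>) simp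
    finally show False by simp
  qed
  then show ?thesis
    using solution_energy[OF sol origin(1) mem origin(2) _ \<open>0 \<le> c\<close>]
    by (simp add: s_def[symmetric] c_def[symmetric])
qed

text \<open>Supplies a ball depending on \<open>\<Delta>\<close> alone, from which the growth
  constants in the dwell time are taken.\<close>

lemma solution_bounded:
  assumes sol: "hybrid_solution H E \<phi>" and "norm (\<phi> 0 0) \<le> \<Delta>" and mem: "(T, J) \<in> E"
  shows "norm (\<phi> T J) \<le> norm_bound (energy_bound \<Delta>)"
proof -
  have "hybrid_time_domain E" using sol by (simp add: hybrid_solution_def hybrid_arc_def)
  note origin = hybrid_time_domain_origin[OF this mem]
  have "energy (\<phi> T J) \<le> energy (\<phi> 0 0)"
    using solution_energy[OF sol origin(1) mem origin(2) _ order_refl]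
      class_K_zero[OF class_Kinf_imp_K[OF class_Kinf_decay]] energy_nonneg[of "\<phi> 0 0"] by simp
  also have "\<dots> \<le> energy_bound (norm (\<phi> 0 0))" by (rule energy_le_energy_bound)
  also have "\<dots> \<le> energy_bound \<Delta>"
    using assms(2) by (intro class_K_mono[OF class_Kinf_imp_K[OF class_Kinf_energy_bound]]) auto
  finally have "norm_bound (energy (\<phi> T J)) \<le> norm_bound (energy_bound \<Delta>)"
    by (intro class_K_mono[OF class_Kinf_imp_K[OF class_Kinf_norm_bound] energy_nonneg])
  then show ?thesis using norm_le_norm_bound[of "\<phi> T J"] by linarith
qed

section \<open>Dwell time and number of jumps\<close>

text \<open>
  Let \<open>M\<close> be the maximum of \<open>(x, e)\<close> between two jumps, where the speed is at most \<open>L * M\<close>. The error starts at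
  zero and at the next jump dominates the state, so both the final value and \<open>M\<close> minus it are
  bounded by multiples of \<open>M\<close> times the elapsed time. Dividing by \<open>M\<close> bounds this time from below.
\<close>

lemma dwell_time:
  obtains \<tau> where "0 < \<tau>"
    "\<And>E \<phi> j s s'. \<lbrakk>hybrid_solution H E \<phi>; norm (\<phi> 0 0) \<le> \<Delta>; jump_time E j s; jump_time E (Suc j) s';
      \<phi> s' (Suc j) \<noteq> 0\<rbrakk> \<Longrightarrow> \<tau> \<le> s' - s"
proof -
  define R where "R = norm_bound (energy_bound \<Delta>)"
  define S :: "('x \<times> 'e) set" where "S = cball 0 R \<times> cball 0 R"
  have "compact S" by (simp add: S_def compact_Times)
  obtain L1 L2 where "0 \<le> L1" "0 \<le> L2" and
    L12: "\<And>x e. (x, e) \<in> S \<Longrightarrow> norm (f (x, e)) \<le> L1 * (norm x + norm e)"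
      "\<And>x e. (x, e) \<in> S \<Longrightarrow> K_inverse \<alpha>V_low (W e) \<le> L2 * norm e"
    using f_growth[OF \<open>compact S\<close>] by fast
  obtain L3 where "0 \<le> L3" and
    L3: "\<And>x e. (x, e) \<in> S \<Longrightarrow> norm (g (x, e)) \<le> L3 * (norm x + norm e)"
    using g_growth[OF \<open>compact S\<close>] by fast
  \<comment> \<open>The factor 2 comes from \<open>norm x + norm e \<le> 2 * norm (x, e)\<close>;
    adding 1 keeps \<open>L\<close> positive.\<close>
  define L where "L = 2 * (L1 + L3) + 1"
  have "0 < L" using \<open>0 \<le> L1\<close> \<open>0 \<le> L3\<close> by (simp add: L_def)
  show thesis
  \<comment> \<open>With \<open>M\<close> the maximum of \<open>norm (z t)\<close>, the final value
    is at most \<open>(1 + L2) * L * M * (s' - s)\<close> and the gap from it to \<open>M\<close> at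
    most \<open>L * M * (s' - s)\<close>; hence the factor \<open>2 + L2\<close>.\<close>
  proof (rule that[of "1 / ((2 + L2) * L)"])
    show "0 < 1 / ((2 + L2) * L)" using \<open>0 < L\<close> \<open>0 \<le> L2\<close> by simp
    fix E :: "(real \<times> nat) set" and \<phi> :: "real \<Rightarrow> nat \<Rightarrow> 'x \<times> 'e \<times> real" and j :: nat and s s' :: real
    assume sol: "hybrid_solution H E \<phi>" and \<Delta>: "norm (\<phi> 0 0) \<le> \<Delta>"
      and jumps: "jump_time E j s" "jump_time E (Suc j) s'" and nz: "\<phi> s' (Suc j) \<noteq> 0"
    have htd: "hybrid_time_domain E" using sol by (simp add: hybrid_solution_def hybrid_arc_def)
    note ss' = successive_jump_times[OF htd jumps]
    define x where "x t = fst (\<phi> t (Suc j))" for t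
    define e where "e t = fst (snd (\<phi> t (Suc j)))" for t
    define z where "z t = (x t, e t)" for t
    note flow = hybrid_solution_flow[OF sol ss'(2,1)]
    have inS: "z t \<in> S" if "t \<in> {s..s'}" for t
    proof -
      have "(t, Suc j) \<in> E" using ss'(2) that by auto
      from solution_bounded[OF sol \<Delta> this] have "norm (\<phi> t (Suc j)) \<le> R" by (simp add: R_def)
      then show ?thesis
        using norm_components_le[of "\<phi> t (Suc j)"] norm_components_le(1)[of "snd (\<phi> t (Suc j))"]
        by (auto simp: S_def z_def x_def e_def)
    qed
    have speed: "norm (f (z t), g (z t)) \<le> L * norm (z t)" if "t \<in> {s..s'}" for t
    proof -
      have "norm (f (z t), g (z t)) \<le> norm (f (z t)) + norm (g (z t))" by (rule norm_Pair_le)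
      also have "\<dots> \<le> (L1 + L3) * (norm (x t) + norm (e t))"
        using L12(1) L3 inS[OF that] by (force simp: z_def algebra_simps)
      also have "\<dots> \<le> (L1 + L3) * (2 * norm (z t))"
        using \<open>0 \<le> L1\<close> \<open>0 \<le> L3\<close> norm_components_le[of "z t"] by (intro mult_left_mono) (auto simp: z_def)
      also have "\<dots> \<le> L * norm (z t)" by (simp add: L_def algebra_simps)
      finally show ?thesis .
    qed
    have ac_z: "absolutely_continuous_on_interval s s' z"
    proof (rule absolutely_continuous_on_interval_dominated[OF flow(1)])
      fix u v
      have "norm (z v - z u) \<le> norm (x v - x u) + norm (e v - e u)"
        unfolding z_def minus_prod_def by (simp add: norm_Pair_le)
      then show "norm (z v - z u) \<le> 2 * norm (\<phi> v (Suc j) - \<phi> u (Suc j))"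
        using norm_components_le[of "\<phi> v (Suc j) - \<phi> u (Suc j)"]
          norm_components_le(1)[of "snd (\<phi> v (Suc j) - \<phi> u (Suc j))"]
        by (auto simp: x_def e_def)
    qed
    have "continuous_on {s..s'} (\<lambda>t. norm (z t))"
      by (intro continuous_on_norm absolutely_continuous_on_interval_imp_continuous_on[OF ac_z])
    then obtain r where r: "r \<in> {s..s'}" and max: "\<And>t. t \<in> {s..s'} \<Longrightarrow> norm (z t) \<le> norm (z r)"
      using continuous_attains_sup[of "{s..s'}" "\<lambda>t. norm (z t)"] ss'(1) by auto
    define M where "M = norm (z r)"
    \<comment> \<open>Applied at \<open>u = s\<close> for the growth of the error from zero, and at
      \<open>u = r\<close> to compare the maximum with the final value.\<close>
    have inc: "norm (z s' - z u) \<le> L * M * (s' - s)" if u: "u \<in> {s..s'}" for u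
    proof -
      have "norm (z s' - z u) \<le> L * M * (s' - u)"
      proof (rule absolutely_continuous_norm_increment_le)
        show "absolutely_continuous_on_interval u s' z"
          using u by (intro absolutely_continuous_on_interval_subset[OF ac_z]) auto
        show "AE t in lebesgue. t \<in> {u..s'} \<longrightarrow>
            (\<exists>D. norm D \<le> L * M \<and> (z has_vector_derivative D) (at t within {u..s'}))"
          using flow(2)
        proof eventually_elim
          case (elim t)
          show ?case
          proof (intro impI exI conjI)
            assume "t \<in> {u..s'}"
            then have t: "t \<in> {s..s'}" and sub: "{u..s'} \<subseteq> {s..s'}" using u by auto
            have "norm (z t) \<le> M" using max[OF t] by (simp add: M_def)
            then have "L * norm (z t) \<le> L * M" using \<open>0 < L\<close> by simp
            then show "norm (f (z t), g (z t)) \<le> L * M" using speed[OF t] by linarith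
            let ?d = "flow_map H (\<phi> t (Suc j))"
            from elim t have
              "((\<lambda>t. \<phi> t (Suc j)) has_vector_derivative ?d) (at t within {s..s'})" by blast
            then have d: "((\<lambda>t. \<phi> t (Suc j)) has_vector_derivative ?d) (at t within {u..s'})"
              using sub by (rule has_vector_derivative_within_subset)
            have "((\<lambda>t. (fst (\<phi> t (Suc j)), fst (snd (\<phi> t (Suc j))))) has_vector_derivative
                (fst ?d, fst (snd ?d))) (at t within {u..s'})"
              by (intro has_vector_derivative_Pair bounded_linear.has_vector_derivative[OF bounded_linear_fst]
                  bounded_linear.has_vector_derivative[OF bounded_linear_snd] d)
            then show "(z has_vector_derivative (f (z t), g (z t))) (at t within {u..s'})"
              by (simp add: flow_map_components z_def[abs_def] x_def e_def)
          qed
        qed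
      qed (use u in auto)
      also have "\<dots> \<le> L * M * (s' - s)"
        using u \<open>0 < L\<close> by (intro mult_left_mono) (auto simp: M_def)
      finally show ?thesis .
    qed
    have s: "s \<in> {s..s'}" "s' \<in> {s..s'}" using ss'(1) by auto
    have "\<phi> s (Suc j) = jump_map H (\<phi> s j)"
      using sol jumps(1) by (auto simp: hybrid_solution_def jump_time_def)
    then have "e s = 0" by (simp add: e_def event_triggered_system_def split: prod.split)
    have "norm (e s' - e s) \<le> norm (z s' - z s)"
      using norm_components_le(2)[of "z s' - z s"] by (simp add: z_def)
    then have e_le: "norm (e s') \<le> L * M * (s' - s)" using inc[OF s(1)] \<open>e s = 0\<close> by simp
    have "\<phi> s' (Suc j) \<in> jump_set H"
      using sol jumps(2) by (auto simp: hybrid_solution_def jump_time_def)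
    then have jump: "V (x s') \<le> W (e s')" "snd (snd (\<phi> s' (Suc j))) \<le> W (e s')"
        "0 \<le> snd (snd (\<phi> s' (Suc j)))"
      by (auto simp: event_triggered_system_def x_def e_def)
    have "norm (x s') \<le> K_inverse \<alpha>V_low (W (e s'))"
      using jump(1) V_bounds(1)[of "x s'"] by (intro le_K_inverse[OF Kinf(1)]) auto
    also have "\<dots> \<le> L2 * norm (e s')"
      using L12(2) inS[OF s(2)] by (simp add: z_def)
    finally have x_le: "norm (x s') \<le> L2 * norm (e s')" .
    \<comment> \<open>A jump with zero error is possible only at the origin: the jump set then
      forces \<open>V x\<close> and \<open>\<eta>\<close> down to zero.\<close>
    have "e s' \<noteq> 0"
    proof
      assume "e s' = 0"
      then have "x s' = 0" "snd (snd (\<phi> s' (Suc j))) = 0" using x_le jump W_zero by auto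
      then show False using nz \<open>e s' = 0\<close> by (simp add: x_def e_def prod_eq_iff)
    qed
    then have "0 < M" using max[OF s(2)] norm_components_le(2)[of "z s'"] by (auto simp: M_def z_def)
    have "norm (z s') \<le> (1 + L2) * norm (e s')"
      using x_le norm_Pair_le[of "x s'" "e s'"] by (simp add: z_def algebra_simps)
    also have "\<dots> \<le> (1 + L2) * (L * M * (s' - s))" using e_le \<open>0 \<le> L2\<close> by (intro mult_left_mono) auto
    finally have "M \<le> (1 + L2) * (L * M * (s' - s)) + L * M * (s' - s)"
      using inc[OF r] norm_triangle_ineq2[of "z r" "z s'"] by (simp add: M_def norm_minus_commute)
    then have "M * 1 \<le> M * ((2 + L2) * L * (s' - s))" by (simp add: algebra_simps)
    then have "1 \<le> (2 + L2) * L * (s' - s)" using \<open>0 < M\<close> by (simp only: mult_le_cancel_left_pos)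
    then show "1 / ((2 + L2) * L) \<le> s' - s"
      using \<open>0 < L\<close> \<open>0 \<le> L2\<close> by (simp add: divide_le_eq mult.commute mult.left_commute)
  qed
qed

text \<open>Each of the \<open>J - 1\<close> flow intervals between successive jumps lasts at least
  \<open>\<tau>\<close>, since a state that is nonzero at the end was never zero before. The initial
  interval may be arbitrarily short, whence the summand 1.\<close>

lemma jump_count:
  assumes sol: "hybrid_solution H E \<phi>" and mem: "(T, J) \<in> E" and nz: "\<phi> T J \<noteq> 0" and "0 < \<tau>"
    and dwell: "\<And>j s s'. \<lbrakk>jump_time E j s; jump_time E (Suc j) s'; \<phi> s' (Suc j) \<noteq> 0\<rbrakk> \<Longrightarrow> \<tau> \<le> s' - s"
  shows "real J \<le> 1 + T / \<tau>"
proof (cases J)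
  case 0
  have "hybrid_time_domain E" using sol by (simp add: hybrid_solution_def hybrid_arc_def)
  then show ?thesis using hybrid_time_domain_origin[OF _ mem] 0 \<open>0 < \<tau>\<close> by simp
next
  case (Suc N)
  have htd: "hybrid_time_domain E" using sol by (simp add: hybrid_solution_def hybrid_arc_def)
  obtain t where t: "t 0 = 0" "\<And>j. j \<le> J \<Longrightarrow> t j \<le> t (Suc j)" "t (Suc J) = T"
    "\<And>r j. (r, j) \<in> E \<and> r \<le> T \<and> j \<le> J \<longleftrightarrow> j \<le> J \<and> t j \<le> r \<and> r \<le> t (Suc j)"
    using hybrid_time_domainE[OF htd mem] by metis
  have jump: "jump_time E i (t (Suc i))" "t (Suc i) \<le> T" if "Suc i \<le> J" for i
    using t(4)[of "t (Suc i)" i] t(4)[of "t (Suc i)" "Suc i"] t(2)[of i] t(2)[of "Suc i"] that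
    by (auto simp: jump_time_def)
  have "Suc i \<le> J \<Longrightarrow> real i * \<tau> \<le> t (Suc i)" for i
  proof (induction i)
    case 0
    then show ?case using t(1) t(2)[of 0] by simp
  next
    case (Suc i)
    have mem': "(t (Suc (Suc i)), Suc i) \<in> E" using jump(1)[OF Suc.prems] by (simp add: jump_time_def)
    have "\<phi> (t (Suc (Suc i))) (Suc i) \<noteq> 0"
      using solution_stays_zero[OF sol mem' mem jump(2)[OF Suc.prems]] Suc.prems nz by auto
    then have "\<tau> \<le> t (Suc (Suc i)) - t (Suc i)"
      using dwell[OF jump(1) jump(1)] Suc.prems by simp
    then show ?case using Suc by (simp add: algebra_simps)
  qed
  from this[of N] have "real N * \<tau> \<le> T" using jump(2)[of N] Suc by simp
  then show ?thesis using Suc \<open>0 < \<tau>\<close> by (simp add: field_simps)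
qed

section \<open>Stability and dwell time of the origin\<close>

lemma S_GAS_zero: "S_GAS H {0}"
  unfolding S_GAS_def
proof (intro conjI allI impI)
  fix \<Delta> :: real
  obtain \<tau> where "0 < \<tau>" and
    dwell: "\<And>E \<phi> j s s'. \<lbrakk>hybrid_solution H E \<phi>; norm (\<phi> 0 0) \<le> \<Delta>; jump_time E j s; jump_time E (Suc j) s';
      \<phi> s' (Suc j) \<noteq> 0\<rbrakk> \<Longrightarrow> \<tau> \<le> s' - s"
    using dwell_time[of \<Delta>] by metis
  \<comment> \<open>Chosen so that the jump count gives
    \<open>1 + T + J \<le> 2 + T + T / \<tau> \<le> (1 + T) * K\<close>.\<close>
  define K where "K = 2 + 1 / \<tau>"
  have "0 < K" using \<open>0 < \<tau>\<close> by (simp add: K_def add_pos_nonneg)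
  define A where "A v = norm_bound (K_inverse decay v)" for v
  \<comment> \<open>The bound may see the initial state only through its norm, so
    \<open>energy_bound r\<close> takes the place of the initial energy; \<open>K\<close> pays for
    the jumps in the denominator.\<close>
  define B where "B r = K * (decay (energy_bound r) + energy_bound r)" for r
  have A: "class_K A" unfolding A_def[abs_def]
    by (rule class_Kinf_imp_K[OF class_Kinf_compose[OF class_Kinf_norm_bound class_Kinf_K_inverse[OF class_Kinf_decay]]])
  have B: "class_K B" unfolding B_def[abs_def]
    by (rule class_Kinf_imp_K[OF class_Kinf_scale[OF class_Kinf_add[OF class_Kinf_compose[OF class_Kinf_decay
            class_Kinf_energy_bound] class_Kinf_energy_bound] \<open>0 < K\<close>]])
  have "norm (\<phi> T J) \<le> A (B (norm (\<phi> 0 0)) / (1 + T + real J))"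
    if sol: "hybrid_solution H E \<phi>" and \<Delta>: "norm (\<phi> 0 0) \<le> \<Delta>" and mem: "(T, J) \<in> E" for E \<phi> T J
  proof -
    have "hybrid_time_domain E" using sol by (simp add: hybrid_solution_def hybrid_arc_def)
    note origin = hybrid_time_domain_origin[OF this mem]
    show ?thesis
    \<comment> \<open>At the origin jumps are not controlled by time, but the claim there is mere
      nonnegativity of the bound.\<close>
    proof (cases "\<phi> T J = 0")
      case True
      then show ?thesis
        using origin(2) by (auto intro!: class_K_nonneg[OF A] divide_nonneg_nonneg class_K_nonneg[OF B])
    next
      case False
      define s where "s = energy (\<phi> 0 0)"
      define s' where "s' = energy_bound (norm (\<phi> 0 0))"
      have "0 \<le> s" "s \<le> s'" by (simp_all add: s_def s'_def energy_nonneg energy_le_energy_bound)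
      then have ds: "0 \<le> decay s + s" "decay s + s \<le> decay s' + s'"
        using class_K_nonneg[OF class_Kinf_imp_K[OF class_Kinf_decay]]
          class_K_mono[OF class_Kinf_imp_K[OF class_Kinf_decay]] by (auto intro!: add_nonneg_nonneg add_mono)
      have "real J \<le> 1 + T / \<tau>"
        by (rule jump_count[OF sol mem False \<open>0 < \<tau>\<close> dwell[OF sol \<Delta>]])
      moreover have "(1 + T) * K = 2 + 2 * T + 1 / \<tau> + T / \<tau>" by (simp add: K_def algebra_simps add_divide_distrib)
      moreover have "0 \<le> 1 / \<tau>" using \<open>0 < \<tau>\<close> by simp
      ultimately have "1 + T + real J \<le> (1 + T) * K" using origin(2) by linarith
      then have "K * (decay s + s) / ((1 + T) * K) \<le> K * (decay s + s) / (1 + T + real J)"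
        using \<open>0 < K\<close> origin(2) ds by (intro divide_left_mono) simp_all
      moreover have "(decay s + s) / (1 + T) = K * (decay s + s) / ((1 + T) * K)"
        using \<open>0 < K\<close> by simp
      moreover have "K * (decay s + s) / (1 + T + real J) \<le> B (norm (\<phi> 0 0)) / (1 + T + real J)"
        using \<open>0 < K\<close> origin(2) ds unfolding B_def s'_def[symmetric]
        by (intro divide_right_mono mult_left_mono) auto
      ultimately have le: "(decay s + s) / (1 + T) \<le> B (norm (\<phi> 0 0)) / (1 + T + real J)" by linarith
      have "norm (\<phi> T J) \<le> norm_bound (energy (\<phi> T J))" by (rule norm_le_norm_bound)
      also have "\<dots> \<le> A ((decay s + s) / (1 + T))"
        unfolding A_def s_def
        by (intro class_K_mono[OF class_Kinf_imp_K[OF class_Kinf_norm_bound] energy_nonneg]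
            solution_energy_rate[OF sol mem])
      also have "\<dots> \<le> A (B (norm (\<phi> 0 0)) / (1 + T + real J))"
        using le ds origin(2) by (intro class_K_mono[OF A]) auto
      finally show ?thesis .
    qed
  qed
  then show "\<exists>\<beta>. class_KLL \<beta> \<and> (\<forall>E \<phi>. hybrid_solution H E \<phi> \<and> infdist (\<phi> 0 0) {0} \<le> \<Delta> \<longrightarrow>
      (\<forall>(t, j)\<in>E. infdist (\<phi> t j) {0} \<le> \<beta> (infdist (\<phi> 0 0) {0}) t (real j)))"
    by (intro exI[of _ "\<lambda>s t u. A (B s / (1 + t + u))"] conjI class_KLL_quotient A B) auto
qed simp

lemma semiglobal_dwell_time_zero: "semiglobal_dwell_time H {0}"
  unfolding semiglobal_dwell_time_def
proof (intro conjI allI impI)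
  show "forward_invariant H {0}"
    unfolding forward_invariant_def
  proof (intro allI impI ballI, elim conjE, clarsimp)
    fix E :: "(real \<times> nat) set" and \<phi> :: "real \<Rightarrow> nat \<Rightarrow> 'x \<times> 'e \<times> real" and T J
    assume sol: "hybrid_solution H E \<phi>" and "\<phi> 0 0 = 0" and mem: "(T, J) \<in> E"
    have "hybrid_time_domain E" using sol by (simp add: hybrid_solution_def hybrid_arc_def)
    from hybrid_time_domain_origin[OF this mem] show "\<phi> T J = 0"
      using solution_stays_zero[OF sol _ mem] \<open>\<phi> 0 0 = 0\<close> by blast
  qed
  fix \<Delta> :: real
  obtain \<tau> where "0 < \<tau>" and
    dwell: "\<And>E \<phi> j s s'. \<lbrakk>hybrid_solution H E \<phi>; norm (\<phi> 0 0) \<le> \<Delta>; jump_time E j s; jump_time E (Suc j) s';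
      \<phi> s' (Suc j) \<noteq> 0\<rbrakk> \<Longrightarrow> \<tau> \<le> s' - s"
    using dwell_time[of \<Delta>] by metis
  have "\<tau> \<le> s' - s"
    if sol: "hybrid_solution H E \<phi>" and "norm (\<phi> 0 0) \<le> \<Delta>" and jumps: "jump_time E j s" "jump_time E (Suc j) s'"
      and nz: "\<forall>t\<in>{s..s'}. \<phi> t (Suc j) \<noteq> 0" for E \<phi> j s s'
  proof -
    have "hybrid_time_domain E" using sol by (simp add: hybrid_solution_def hybrid_arc_def)
    from successive_jump_times(1)[OF this jumps] show ?thesis using that by (intro dwell) auto
  qed
  then show "\<exists>\<tau>>0. \<forall>E \<phi>. hybrid_solution H E \<phi> \<and> infdist (\<phi> 0 0) {0} \<le> \<Delta> \<longrightarrow>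
      (\<forall>j s s'. jump_time E j s \<and> jump_time E (Suc j) s' \<and>
         (\<forall>t\<in>{s..s'}. \<phi> t (Suc j) \<notin> {0}) \<longrightarrow> \<tau> \<le> s' - s)"
    using \<open>0 < \<tau>\<close> by (intro exI[of _ \<tau>]) (simp, blast)
qed

end

theorem theorem3:
  fixes f :: "(real^'nx) \<times> (real^'ne) \<Rightarrow> real^'nx"
    and g :: "(real^'nx) \<times> (real^'ne) \<Rightarrow> real^'ne"
    and \<delta> \<alpha>V_low \<alpha>V_up \<alpha> \<gamma> :: "real \<Rightarrow> real"
    and \<sigma> :: real
    and V :: "real^'nx \<Rightarrow> real"
  assumes f_cont: "continuous_on UNIV f"
    and g_cont: "continuous_on UNIV g"
    and \<delta>: "class_Kinf \<delta>"
    and \<sigma>: "0 < \<sigma>" "\<sigma> < 1"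
    and V_smooth: "smooth V"
    and Kinf: "class_Kinf \<alpha>V_low" "class_Kinf \<alpha>V_up" "class_Kinf \<alpha>" "class_Kinf \<gamma>"
    and V_bounds: "\<forall>x. \<alpha>V_low (norm x) \<le> V x \<and> V x \<le> \<alpha>V_up (norm x)"
    and V_flow: "\<forall>x e. frechet_derivative V (at x) (f (x, e)) \<le> - \<alpha> (V x) + \<gamma> (norm e)"
    and f_growth: "\<forall>S. compact S \<longrightarrow> (\<exists>L1\<ge>0. \<exists>L2\<ge>0. \<forall>(x, e)\<in>S.
        norm (f (x, e)) \<le> L1 * (norm x + norm e) \<and>
        K_inverse \<alpha>V_low (gamma_tilde \<sigma> \<alpha> \<gamma> (norm e)) \<le> L2 * norm e)"
    and gamma_tilde_Lipschitz: "locally_lipschitz_on {0..} (gamma_tilde \<sigma> \<alpha> \<gamma>)"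
    and g_growth: "\<forall>S. compact S \<longrightarrow> (\<exists>L3\<ge>0. \<forall>(x, e)\<in>S.
        norm (g (x, e)) \<le> L3 * (norm x + norm e))"
  shows "S_GAS (event_triggered_system f g \<delta> V (\<lambda>e. gamma_tilde \<sigma> \<alpha> \<gamma> (norm e))) {0} \<and>
         semiglobal_dwell_time (event_triggered_system f g \<delta> V (\<lambda>e. gamma_tilde \<sigma> \<alpha> \<gamma> (norm e))) {0}"
proof -
  interpret event_triggered f g \<delta> \<alpha>V_low \<alpha>V_up \<alpha> \<gamma> \<sigma> V
    using assms by unfold_locales blast+
  show ?thesis using S_GAS_zero semiglobal_dwell_time_zero by blast
qed

end
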